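(* For every non-negative integer $n$ there exist $a,b,c,d\in\mathbb{N}_0$ such that $$n=a(2a-1)+b(2b-1)+c(2c+1)+d(2d+1).$$
   Context: $\mathbb{N}_0=\{0,1,2,\dots\}$ denotes the set of non-negative integers. *)

theory Defs
  imports Main
begin

end

theory Submission
  imports
    Defs
    "HOL-Number_Theory.Number_Theory"
    "HOL-Computational_Algebra.Squarefree"
begin

text \<open>
  With \<open>S = a + b + c + d\<close>, \<open>C = a + b - c - d - 1\<close>, \<open>v = a - b + c - d\<close> and \<open>w = a - b - c + d\<close> the
  equation becomes \<open>2n + 1 = S\<^sup>2 + C\<^sup>2 + v\<^sup>2 + w\<^sup>2\<close>. Take \<open>S\<close> maximal with \<open>S \<equiv> n (mod 2)\<close> and
  \<open>S\<^sup>2 \<le> 2n + 1\<close>. Then \<open>2n + 1 - S\<^sup>2\<close> is 1 or 2 modulo 4, hence a sum of three squares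
  \<open>C\<^sup>2 + v\<^sup>2 + w\<^sup>2\<close>; the congruences needed to recover \<open>a, b, c, d\<close> can be arranged by permuting the
  squares and changing a sign, and \<open>S\<close> is so large that \<open>\<bar>C\<bar> + \<bar>v\<bar> + \<bar>w\<bar> < S + 3\<close>, which makes
  \<open>a, b, c, d\<close> non-negative, except for a few small \<open>n\<close>.

  For the three squares theorem let \<open>m\<close> be squarefree, 1 or 2 modulo 4, and choose a prime
  \<open>p \<equiv> 1 (mod 4)\<close> such that \<open>-p\<close> is a square modulo \<open>m\<close>; for \<open>m = 2m'\<close> also prescribe the class of
  \<open>p\<close> modulo 8. By reciprocity \<open>m\<close> is then a square modulo \<open>p\<close>, so \<open>m t\<^sup>2 = z\<^sup>2 + p s\<^sup>2\<close> is solvable by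
  Legendre's theorem, and so is \<open>p u\<^sup>2 = v\<^sup>2 + w\<^sup>2\<close>. Hence \<open>m\<close> is a sum of three rational squares, and
  of three integral ones by Davenport and Cassels.

  The conditions on \<open>p\<close> only involve real characters \<open>\<chi>\<close>, so the prime is found by the real part of
  Dirichlet's theorem: \<open>\<Sum> \<chi>(n) \<Lambda>(n) / n\<close> has bounded partial sums (Mertens, Shapiro) once
  \<open>L(1, \<chi>) \<noteq> 0\<close>, which is Monsky's argument with the Lambert series \<open>\<Sum> \<chi>(n) q\<^sup>n / (1 - q\<^sup>n)\<close>.
\<close>

section \<open>Isotropy of ternary forms and sums of squares\<close>

text \<open>Rounds \<open>x / t\<close> to the nearest integer: \<open>u\<close> is the floor of
  \<open>x / t + 1 / 2\<close>, doubled throughout to stay in the integers.\<close>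

lemma nearest_multiple:
  fixes x t :: int
  assumes "t > 0"
  shows "\<exists>u. 4 * (x - t * u)\<^sup>2 \<le> t\<^sup>2"
proof -
  define u r where "u = (2 * x + t) div (2 * t)" and "r = (2 * x + t) mod (2 * t)"
  have "2 * x + t = 2 * t * u + r"
    unfolding u_def r_def by simp
  moreover have "0 \<le> r" "r < 2 * t"
    unfolding r_def using assms by simp_all
  ultimately have "\<bar>2 * (x - t * u)\<bar> \<le> t"
    by (auto simp: algebra_simps abs_le_iff)
  then have "(2 * (x - t * u))\<^sup>2 \<le> t\<^sup>2"
    using assms by (intro abs_le_square_iff[THEN iffD1]) auto
  then show ?thesis
    by (intro exI[of _ u]) (simp only: power_mult_distrib, simp)
qed

text \<open>Davenport--Cassels: the line through a rational point of the sphere \<open>|X|\<^sup>2 = m\<close> and the nearest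
  lattice point meets the sphere again in a point of smaller denominator.\<close>

lemma three_squares_of_scaled:
  fixes m t x y z :: int
  assumes "t > 0" and "m * t\<^sup>2 = x\<^sup>2 + y\<^sup>2 + z\<^sup>2"
  shows "\<exists>x y z. m = x\<^sup>2 + y\<^sup>2 + z\<^sup>2"
  using assms
proof (induction "nat t" arbitrary: t x y z rule: less_induct)
  case less
  obtain u v w where uvw:
    "4 * (x - t * u)\<^sup>2 \<le> t\<^sup>2" "4 * (y - t * v)\<^sup>2 \<le> t\<^sup>2" "4 * (z - t * w)\<^sup>2 \<le> t\<^sup>2"
    using nearest_multiple[OF less.prems(1)] by metis
  define N k where "N = u\<^sup>2 + v\<^sup>2 + w\<^sup>2" and "k = x * u + y * v + z * w"
  \<comment> \<open>With X = (x, y, z) and U = (u, v, w), the number \<open>e = |X - t U|^2\<close>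
    equals \<open>t * t'\<close>. The quotient \<open>t'\<close> is the new denominator, and
    rounding gives \<open>t' \<le> 3 t / 4\<close>.\<close>
  define t' where "t' = t * (m + N) - 2 * k"
  define e where "e = (x - t * u)\<^sup>2 + (y - t * v)\<^sup>2 + (z - t * w)\<^sup>2"
  have te: "t * t' = e"
    using less.prems(2) unfolding e_def t'_def N_def k_def
    by (simp add: power2_eq_square algebra_simps)
  have e_nonneg: "e \<ge> 0" unfolding e_def by simp
  show ?case
  proof (cases "e = 0")
    case True
    then have "x - t * u = 0" "y - t * v = 0" "z - t * w = 0"
      unfolding e_def by (smt (verit) zero_le_power2 power2_eq_iff zero_eq_power2)+
    then have "x = t * u" "y = t * v" "z = t * w" by simp_all
    then have "m * t\<^sup>2 = t\<^sup>2 * (u\<^sup>2 + v\<^sup>2 + w\<^sup>2)"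
      using less.prems(2) by (simp add: power_mult_distrib algebra_simps)
    then show ?thesis using less.prems(1) by auto
  next
    case False
    then have pos: "t' > 0"
      using te e_nonneg less.prems(1) by (smt (verit) mult_nonneg_nonpos)
    have "4 * e \<le> 3 * t\<^sup>2"
      using add_mono[OF add_mono[OF uvw(1,2)] uvw(3)] unfolding e_def distrib_left by simp
    then have "4 * (t * t') \<le> 3 * (t * t)" using te by (simp add: power2_eq_square)
    then have "t * (4 * t') \<le> t * (3 * t)" by (simp add: algebra_simps)
    then have "4 * t' \<le> 3 * t" using less.prems(1) by simp
    then have lt: "nat t' < nat t" using pos less.prems(1) by linarith
    \<comment> \<open>\<open>(c X + d U) / t'\<close> is the second intersection of the sphere with
      the line through X / t and U.\<close>
    define c d where "c = N - m" and "d = 2 * (m * t - k)"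
    have "m * t'\<^sup>2 = (c * x + d * u)\<^sup>2 + (c * y + d * v)\<^sup>2 + (c * z + d * w)\<^sup>2"
    proof -
      have "(c * x + d * u)\<^sup>2 + (c * y + d * v)\<^sup>2 + (c * z + d * w)\<^sup>2
          = c\<^sup>2 * (x\<^sup>2 + y\<^sup>2 + z\<^sup>2) + 2 * c * d * k + d\<^sup>2 * N"
        unfolding N_def k_def by (simp add: power2_eq_square algebra_simps)
      also have "\<dots> = c\<^sup>2 * (m * t\<^sup>2) + 2 * c * d * k + d\<^sup>2 * N"
        by (simp only: less.prems(2))
      also have "\<dots> = m * t'\<^sup>2"
        unfolding c_def d_def t'_def by (simp add: power2_eq_square algebra_simps)
      finally show ?thesis by simp
    qed
    from less.hyps[OF lt pos this] show ?thesis .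
  qed
qed

section \<open>Small zeros of ternary forms\<close>

lemma small_lattice_point:
  fixes m p \<alpha> \<beta> A B D :: int
  assumes "m > 0" "p > 0" "A > 0" "B > 0" "D > 0" and large: "A * B * D > m * p"
  shows "\<exists>t z s. (t, z, s) \<noteq> (0, 0, 0) \<and> \<bar>t\<bar> < A \<and> \<bar>z\<bar> < B \<and> \<bar>s\<bar> < D
           \<and> m dvd z - \<alpha> * s \<and> p dvd z - \<beta> * t"
proof -
  \<comment> \<open>Pigeonhole: the box \<open>X\<close> holds \<open>A B D\<close> points but
    \<open>f\<close> takes at most \<open>m p\<close> values, so two points collide, and their
    difference satisfies both congruences.\<close>
  define f where "f = (\<lambda>(t, z, s). ((z - \<alpha> * s) mod m, (z - \<beta> * t) mod p))"
  define X where "X = {0..<A} \<times> {0..<B} \<times> {0..<D}"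
  have "f ` X \<subseteq> {0..<m} \<times> {0..<p}"
    using assms by (auto simp: f_def)
  then have "card (f ` X) \<le> card ({0..<m} \<times> {0..<p})"
    by (intro card_mono) auto
  also have "\<dots> = nat m * nat p" by (simp add: card_cartesian_product)
  also have "\<dots> = nat (m * p)" using assms by (simp add: nat_mult_distrib)
  also have "\<dots> < nat (A * B * D)" using large assms by simp
  also have "\<dots> = card X"
    using assms by (simp add: X_def card_cartesian_product nat_mult_distrib)
  finally have "\<not> inj_on f X" by (rule pigeonhole)
  then obtain t z s t' z' s' where *:
    "(t, z, s) \<in> X" "(t', z', s') \<in> X" "f (t, z, s) = f (t', z', s')" "(t, z, s) \<noteq> (t', z', s')"
    unfolding inj_on_def by (metis prod_cases3)
  have "m dvd (z - \<alpha> * s) - (z' - \<alpha> * s')" "p dvd (z - \<beta> * t) - (z' - \<beta> * t')"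
    using *(3) by (simp_all add: f_def mod_eq_dvd_iff)
  then have "m dvd (z - z') - \<alpha> * (s - s')" "p dvd (z - z') - \<beta> * (t - t')"
    by (simp_all add: algebra_simps)
  moreover have "\<bar>t - t'\<bar> < A" "\<bar>z - z'\<bar> < B" "\<bar>s - s'\<bar> < D"
    using *(1,2) by (auto simp: X_def)
  moreover have "(t - t', z - z', s - s') \<noteq> (0, 0, 0)" using *(4) by auto
  ultimately show ?thesis by blast
qed

text \<open>Serves to choose the sides of a box: \<open>|x| < a\<close> forces
  \<open>x^2 < n\<close>, while \<open>a^2\<close> is still at least \<open>n\<close>.\<close>

lemma ceiling_sqrt_int:
  fixes n :: int
  assumes "n > 0"
  shows "\<exists>a>0. (a - 1)\<^sup>2 < n \<and> n \<le> a\<^sup>2"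
proof -
  define P where "P = (\<lambda>k::nat. n \<le> (int k)\<^sup>2)"
  define k where "k = (LEAST k. P k)"
  have "P (nat n)" unfolding P_def using assms by (simp add: self_le_power)
  then have k: "P k" unfolding k_def by (rule LeastI)
  then have "k > 0" using assms unfolding P_def by (cases k) auto
  then have "\<not> P (k - 1)" unfolding k_def by (intro not_less_Least) simp
  then have "(int k - 1)\<^sup>2 < n" using \<open>k > 0\<close> unfolding P_def by (simp add: of_nat_diff)
  then show ?thesis
    using k \<open>k > 0\<close> unfolding P_def by (intro exI[of _ "int k"]) simp
qed

text \<open>Modulo \<open>m\<close> and modulo \<open>p\<close> the form
  \<open>f = m t^2 - z^2 - p s^2\<close> factors into linear forms. The congruences of a short
  lattice vector kill one factor each, so \<open>m p\<close> divides \<open>f\<close>, and its size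
  leaves only \<open>f = 0\<close> and \<open>f = - m p\<close>.\<close>

lemma legendre_form_isotropic:
  fixes m p \<alpha> \<beta> :: int
  assumes pos: "m > 0" "p > 0" and cop: "coprime m p" and nonsquare: "\<not> ((\<exists>k. m = k\<^sup>2) \<and> (\<exists>k. p = k\<^sup>2))"
    and \<alpha>: "m dvd \<alpha>\<^sup>2 + p" and \<beta>: "p dvd \<beta>\<^sup>2 - m"
  shows "\<exists>t z s. t \<noteq> 0 \<and> m * t\<^sup>2 = z\<^sup>2 + p * s\<^sup>2"
proof -
  have mp: "m * p > 0" using pos by simp
  obtain A where A: "A > 0" "(A - 1)\<^sup>2 < p" "p \<le> A\<^sup>2" using ceiling_sqrt_int[OF pos(2)] by blast
  obtain B where B: "B > 0" "(B - 1)\<^sup>2 < m * p" "m * p \<le> B\<^sup>2" using ceiling_sqrt_int[OF mp] by blast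
  obtain D where D: "D > 0" "(D - 1)\<^sup>2 < m" "m \<le> D\<^sup>2" using ceiling_sqrt_int[OF pos(1)] by blast
  \<comment> \<open>The box must hold strictly more than \<open>m p\<close> points. Equality could
    only occur for \<open>p = A^2\<close> and \<open>m = D^2\<close> together, which
    \<open>nonsquare\<close> rules out.\<close>
  have "m * p < D\<^sup>2 * A\<^sup>2"
  proof (cases "p = A\<^sup>2")
    case True
    then have "m < D\<^sup>2" using D(3) nonsquare by (metis le_less)
    then show ?thesis using True pos by (simp add: mult_strict_right_mono)
  next
    case False
    then have "m * p < m * A\<^sup>2" using A(3) pos by (intro mult_strict_left_mono) auto
    also have "\<dots> \<le> D\<^sup>2 * A\<^sup>2" using D(3) by (intro mult_right_mono) auto
    finally show ?thesis .
  qed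
  then have "(m * p) * (m * p) < (m * p) * (D\<^sup>2 * A\<^sup>2)"
    using mp by (rule mult_strict_left_mono)
  also have "\<dots> \<le> B\<^sup>2 * (D\<^sup>2 * A\<^sup>2)" using B(3) by (intro mult_right_mono) auto
  also have "\<dots> = (A * B * D)\<^sup>2" by (simp add: power_mult_distrib)
  finally have "(m * p)\<^sup>2 < (A * B * D)\<^sup>2" by (simp only: power2_eq_square)
  then have "m * p < A * B * D"
    by (rule power_less_imp_less_base) (use A B D in auto)
  from small_lattice_point[OF pos A(1) B(1) D(1) this, of \<alpha> \<beta>]
  obtain t z s where tzs: "(t, z, s) \<noteq> (0, 0, 0)" "\<bar>t\<bar> < A" "\<bar>z\<bar> < B" "\<bar>s\<bar> < D"
    "m dvd z - \<alpha> * s" "p dvd z - \<beta> * t" by blast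
  have sq_le: "x\<^sup>2 \<le> (b - 1)\<^sup>2" if "\<bar>x\<bar> < b" for x b :: int
    using that by (intro abs_le_square_iff[THEN iffD1]) auto
  have bounds: "t\<^sup>2 < p" "z\<^sup>2 < m * p" "s\<^sup>2 < m"
    using sq_le[OF tzs(2)] sq_le[OF tzs(3)] sq_le[OF tzs(4)] A(2) B(2) D(2) by linarith+
  define f where "f = m * t\<^sup>2 - z\<^sup>2 - p * s\<^sup>2"
  have "m dvd f"
  proof -
    have "f = m * t\<^sup>2 - (z - \<alpha> * s) * (z + \<alpha> * s) - (\<alpha>\<^sup>2 + p) * s\<^sup>2"
      unfolding f_def by (simp add: power2_eq_square algebra_simps)
    then show ?thesis using tzs(5) \<alpha> by (metis dvd_diff dvd_mult2 dvd_triv_left)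
  qed
  moreover have "p dvd f"
  proof -
    have "f = - ((\<beta>\<^sup>2 - m) * t\<^sup>2) - (z - \<beta> * t) * (z + \<beta> * t) - p * s\<^sup>2"
      unfolding f_def by (simp add: power2_eq_square algebra_simps)
    then show ?thesis using tzs(6) \<beta> by (metis dvd_diff dvd_minus_iff dvd_mult2 dvd_triv_left)
  qed
  ultimately have "m * p dvd f" using cop by (simp add: divides_mult)
  then obtain g where g: "f = m * p * g" by (auto elim: dvdE)
  have "m * t\<^sup>2 < m * p" "p * s\<^sup>2 < m * p" "m * t\<^sup>2 \<ge> 0" "p * s\<^sup>2 \<ge> 0" "z\<^sup>2 \<ge> 0"
    using bounds pos by (auto simp: mult.commute[of m p])
  then have "f < m * p" "f > - 2 * (m * p)"
    using bounds(2) unfolding f_def by linarith+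
  then have "m * p * g < m * p * 1" "m * p * (-2) < m * p * g" using g by auto
  then have "g < 1" "-2 < g" using mp mult_less_cancel_left_pos by blast+
  then consider "g = 0" | "g = -1" by linarith
  then show ?thesis
  proof cases
    case 1
    then have eq: "m * t\<^sup>2 = z\<^sup>2 + p * s\<^sup>2" using g unfolding f_def by simp
    have "t \<noteq> 0"
    proof
      assume "t = 0"
      then have "z\<^sup>2 + p * s\<^sup>2 = 0" using eq by simp
      then have "z = 0" "s = 0" using pos
        by (smt (verit) mult_pos_pos zero_le_power2 zero_less_power2 zero_eq_power2 mult_nonneg_nonneg)+
      with \<open>t = 0\<close> tzs(1) show False by simp
    qed
    with eq show ?thesis by blast
  next
    case 2
    \<comment> \<open>Here \<open>z\<^sup>2 + p s\<^sup>2 = m (t\<^sup>2 + p)\<close>; multiply by the norm \<open>t\<^sup>2 + p\<close> of \<open>t + \<surd>(-p)\<close>.\<close>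
    then have "m * (t\<^sup>2 + p) = z\<^sup>2 + p * s\<^sup>2" using g unfolding f_def by (simp add: algebra_simps)
    then have "m * (t\<^sup>2 + p)\<^sup>2 = (z\<^sup>2 + p * s\<^sup>2) * (t\<^sup>2 + p)"
      by (simp add: power2_eq_square[of "t\<^sup>2 + p"])
    also have "\<dots> = (z * t - p * s)\<^sup>2 + p * (z + s * t)\<^sup>2"
      by (simp add: power2_eq_square algebra_simps)
    finally have "m * (t\<^sup>2 + p)\<^sup>2 = (z * t - p * s)\<^sup>2 + p * (z + s * t)\<^sup>2" .
    moreover have "t\<^sup>2 + p \<noteq> 0" using pos by (smt (verit) zero_le_power2)
    ultimately show ?thesis by blast
  qed
qed

text \<open>Inverts the linear substitution: \<open>4 a\<close> and \<open>4 b\<close> are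
  \<open>S + (C + 1) \<plusminus> (v + w)\<close>, \<open>4 c\<close> and \<open>4 d\<close> are
  \<open>S - (C + 1) \<plusminus> (v - w)\<close>. The congruences make the quotients integral, and
  \<open>small\<close> makes all four numerators exceed -4, so the integers are
  non-negative.\<close>

lemma hexagonal_of_four_squares:
  fixes n S C v w :: int
  assumes eq: "2 * n + 1 = S\<^sup>2 + C\<^sup>2 + v\<^sup>2 + w\<^sup>2"
    and small: "\<bar>C\<bar> + \<bar>v\<bar> + \<bar>w\<bar> < S + 3"
    and four: "4 dvd S + C + 1 + v + w" and even_vw: "even (v + w)" and even_Cw: "even (C + 1 + w)"
  shows "\<exists>a b c d :: nat. n = int a * (2 * int a - 1) + int b * (2 * int b - 1)
                 + int c * (2 * int c + 1) + int d * (2 * int d + 1)"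
proof -
  obtain a where a: "S + C + 1 + v + w = 4 * a" using four by (elim dvdE)
  obtain e where e: "v + w = 2 * e" using even_vw by (elim evenE)
  obtain h where h: "C + 1 + w = 2 * h" using even_Cw by (elim evenE)
  define b c d where "b = a - e" and "c = a - h" and "d = a - e - h + w"
  have S: "S = a + b + c + d" and C: "C = a + b - c - d - 1"
    and v: "v = a - b + c - d" and w: "w = a - b - c + d"
    using a e h unfolding b_def c_def d_def by linarith+
  have nonneg: "a \<ge> 0" "b \<ge> 0" "c \<ge> 0" "d \<ge> 0"
    using small unfolding S C v w by linarith+
  have "2 * n = 2 * (a * (2 * a - 1) + b * (2 * b - 1) + c * (2 * c + 1) + d * (2 * d + 1))"
    using eq unfolding S C v w by (simp add: power2_eq_square algebra_simps)
  then have "n = a * (2 * a - 1) + b * (2 * b - 1) + c * (2 * c + 1) + d * (2 * d + 1)"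
    by simp
  then show ?thesis
    using nonneg by (intro exI[of _ "nat a"] exI[of _ "nat b"] exI[of _ "nat c"] exI[of _ "nat d"]) simp
qed

section \<open>Elementary bounds for the von Mangoldt function\<close>

lemma abel_summation_bound:
  fixes a b :: "nat \<Rightarrow> real"
  assumes A: "\<And>k. \<bar>\<Sum>i<k. a i\<bar> \<le> C"
    and b: "\<And>i. b (Suc i) \<le> b i" "\<And>i. 0 \<le> b i"
  shows "\<bar>\<Sum>i<N. a i * b i\<bar> \<le> C * b 0"
proof -
  define S where "S k = (\<Sum>i<k. a i)" for k
  have id: "(\<Sum>i<N. a i * b i) = S N * b N + (\<Sum>i<N. S (Suc i) * (b i - b (Suc i)))"
    by (induction N) (simp_all add: S_def algebra_simps)
  have "\<bar>\<Sum>i<N. a i * b i\<bar> \<le> \<bar>S N * b N\<bar> + (\<Sum>i<N. \<bar>S (Suc i) * (b i - b (Suc i))\<bar>)"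
    unfolding id by (rule order.trans[OF abs_triangle_ineq add_left_mono[OF sum_abs]])
  also have "\<dots> \<le> C * b N + (\<Sum>i<N. C * (b i - b (Suc i)))"
    unfolding abs_mult
    by (intro add_mono sum_mono mult_mono)
      (use A[folded S_def] b in \<open>auto intro: order.trans[OF abs_ge_zero]\<close>)
  also have "(\<Sum>i<N. C * (b i - b (Suc i))) = C * (b 0 - b N)"
    by (simp add: sum_distrib_left[symmetric] sum_lessThan_telescope')
  finally show ?thesis by (simp add: algebra_simps)
qed

text \<open>A window of \<open>a\<close> is a difference of two initial sums, whence the factor 2.
  Monotonicity is asked beyond \<open>M\<close> only because \<open>ln n / n\<close> decreases only
  from 3 on.\<close>

lemma abel_summation_bound_tail:
  fixes a b :: "nat \<Rightarrow> real"
  assumes A: "\<And>k. \<bar>\<Sum>n=1..k. a n\<bar> \<le> C"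
    and b: "\<And>i. i > M \<Longrightarrow> b (Suc i) \<le> b i" "\<And>i. i > M \<Longrightarrow> 0 \<le> b i"
  shows "\<bar>\<Sum>n\<in>{M<..N}. a n * b n\<bar> \<le> 2 * C * b (Suc M)"
proof -
  have shift: "(\<Sum>n\<in>{M<..M + k}. f n) = (\<Sum>i<k. f (Suc M + i))" for f :: "nat \<Rightarrow> real" and k
  proof (induction k)
    case (Suc k)
    have "{M<..M + Suc k} = insert (Suc (M + k)) {M<..M + k}" by auto
    with Suc show ?case by simp
  qed simp
  have "\<bar>\<Sum>i<k. a (Suc M + i)\<bar> \<le> 2 * C" for k
  proof -
    have "{1..M + k} = {1..M} \<union> {M<..M + k}" by auto
    then have "(\<Sum>n=1..M + k. a n) = (\<Sum>n=1..M. a n) + (\<Sum>n\<in>{M<..M + k}. a n)"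
      by (simp only:) (rule sum.union_disjoint, auto)
    then have "(\<Sum>i<k. a (Suc M + i)) = (\<Sum>n=1..M + k. a n) - (\<Sum>n=1..M. a n)"
      by (simp add: shift)
    then show ?thesis using A[of "M + k"] A[of M] by linarith
  qed
  from abel_summation_bound[of "\<lambda>i. a (Suc M + i)", OF this, of "\<lambda>i. b (Suc M + i)" "N - M"]
  have "\<bar>\<Sum>i<N - M. a (Suc M + i) * b (Suc M + i)\<bar> \<le> 2 * C * b (Suc M)"
    using b by simp
  moreover have "(\<Sum>i<N - M. a (Suc M + i) * b (Suc M + i)) = (\<Sum>n\<in>{M<..N}. a n * b n)"
  proof (cases "M \<le> N")
    case True
    then show ?thesis using shift[of "\<lambda>n. a n * b n" "N - M"] by simp
  qed simp
  ultimately show ?thesis by simp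
qed

section \<open>Chebyshev and Mertens estimates\<close>

lemma sum_divisors_swap:
  fixes g :: "nat \<Rightarrow> nat \<Rightarrow> real"
  shows "(\<Sum>n=1..N. \<Sum>d | d dvd n. g d n) = (\<Sum>d=1..N. \<Sum>k=1..N div d. g d (d * k))"
proof -
  have "(\<Sum>n=1..N. \<Sum>d | d dvd n. g d n) = (\<Sum>(n, d) \<in> (SIGMA n:{1..N}. {d. d dvd n}). g d n)"
    by (subst sum.Sigma) auto
  also have "\<dots> = (\<Sum>(d, k) \<in> (SIGMA d:{1..N}. {1..N div d}). g d (d * k))"
  proof (rule sum.reindex_bij_witness[of _ "\<lambda>(d, k). (d * k, d)" "\<lambda>(n, d). (d, n div d)"])
    fix x assume "x \<in> (SIGMA n:{1..N}. {d. d dvd n})"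
    then obtain n d where x: "x = (n, d)" "n \<ge> 1" "n \<le> N" "d dvd n" by auto
    then obtain k where k: "n = d * k" by (auto elim: dvdE)
    then have "d \<ge> 1" "k \<ge> 1" using x by (auto simp: Suc_le_eq)
    moreover have "d \<le> d * k" using \<open>k \<ge> 1\<close> by simp
    moreover have "k \<le> N div d" using x k \<open>d \<ge> 1\<close>
      by (simp add: less_eq_div_iff_mult_less_eq mult.commute)
    ultimately show "(case x of (n, d) \<Rightarrow> (d, n div d)) \<in> (SIGMA d:{1..N}. {1..N div d})"
      "(case case x of (n, d) \<Rightarrow> (d, n div d) of (d, k) \<Rightarrow> (d * k, d)) = x"
      "(case case x of (n, d) \<Rightarrow> (d, n div d) of (d, k) \<Rightarrow> g d (d * k)) = (case x of (n, d) \<Rightarrow> g d n)"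
      using x k order.trans[OF \<open>d \<le> d * k\<close>, of N] by auto
  next
    fix y assume "y \<in> (SIGMA d:{1..N}. {1..N div d})"
    then obtain d k where y: "y = (d, k)" "d \<ge> 1" "d \<le> N" "k \<ge> 1" "k \<le> N div d" by auto
    then have "d * k \<le> N"
      by (simp add: less_eq_div_iff_mult_less_eq mult.commute)
    then show "(case y of (d, k) \<Rightarrow> (d * k, d)) \<in> (SIGMA n:{1..N}. {d. d dvd n})"
      "(case case y of (d, k) \<Rightarrow> (d * k, d) of (n, d) \<Rightarrow> (d, n div d)) = y"
      using y by (auto simp: Suc_le_eq)
  qed
  also have "\<dots> = (\<Sum>d=1..N. \<Sum>k=1..N div d. g d (d * k))"
    by (subst sum.Sigma) auto
  finally show ?thesis .
qed

text \<open>Expands \<open>ln n\<close> as the sum of \<open>mangoldt d\<close> over the divisors of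
  \<open>n\<close> and writes \<open>n = d k\<close>. It is applied to the constant 1 and to
  \<open>\<chi> n / n\<close>.\<close>

lemma sum_mult_ln_eq_sum_mangoldt:
  fixes f :: "nat \<Rightarrow> real"
  shows "(\<Sum>n=1..N. f n * ln n) = (\<Sum>d=1..N. mangoldt d * (\<Sum>k=1..N div d. f (d * k)))"
proof -
  have "(\<Sum>n=1..N. f n * ln n) = (\<Sum>n=1..N. \<Sum>d | d dvd n. mangoldt d * f n)"
  proof (rule sum.cong[OF refl])
    fix n assume "n \<in> {1..N}"
    then have "(\<Sum>d | d dvd n. mangoldt d) = ln (real n)"
      using mangoldt_sum[of n, where 'a = real] by simp
    then show "f n * ln n = (\<Sum>d | d dvd n. mangoldt d * f n)"
      by (simp add: sum_distrib_right[symmetric])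
  qed
  also have "\<dots> = (\<Sum>d=1..N. \<Sum>k=1..N div d. mangoldt d * f (d * k))"
    by (rule sum_divisors_swap)
  finally show ?thesis by (simp add: sum_distrib_left)
qed

text \<open>Legendre's formula for the prime factorization of N!, in logarithmic form.\<close>

lemma ln_fact_eq_sum_mangoldt:
  "ln (fact N :: real) = (\<Sum>d=1..N. mangoldt d * real (N div d))"
proof -
  have "ln (fact N :: real) = (\<Sum>n=1..N. ln (real n))"
    by (induction N) (simp_all add: ln_mult)
  then show ?thesis using sum_mult_ln_eq_sum_mangoldt[of "\<lambda>_. 1" N] by simp
qed

text \<open>Chebyshev's argument with the central binomial coefficient. Its logarithm gives
  \<open>mangoldt d\<close> the weight \<open>2 N div d - 2 (N div d)\<close>, which is never
  negative and is at least 1 for \<open>N < d \<le> 2 N\<close>; the coefficient itself is at most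
  \<open>4^N\<close>.\<close>

lemma sum_mangoldt_dyadic: "(\<Sum>d\<in>{N<..2 * N}. mangoldt d) \<le> 2 * real N"
proof -
  have ext: "(\<Sum>d=1..N. mangoldt d * real (N div d)) = (\<Sum>d=1..2 * N. mangoldt d * real (N div d))"
    by (rule sum.mono_neutral_left) (auto simp: div_eq_0_iff)
  have "(\<Sum>d\<in>{N<..2 * N}. mangoldt d)
      \<le> (\<Sum>d\<in>{N<..2 * N}. mangoldt d * (real (2 * N div d) - 2 * real (N div d)))"
  proof (rule sum_mono)
    fix d assume d: "d \<in> {N<..2 * N}"
    then have "1 \<le> 2 * N div d" by (simp add: less_eq_div_iff_mult_less_eq)
    then show "mangoldt d \<le> mangoldt d * (real (2 * N div d) - 2 * real (N div d))"
      using d mangoldt_nonneg[of d] by (simp add: mult_le_cancel_left1)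
  qed
  also have "\<dots> \<le> (\<Sum>d=1..2 * N. mangoldt d * (real (2 * N div d) - 2 * real (N div d)))"
  proof (rule sum_mono2)
    fix d
    have "2 * (N div d) \<le> 2 * N div d"
      by (cases "d = 0") (auto simp: less_eq_div_iff_mult_less_eq mult.assoc intro: div_times_less_eq_dividend)
    then have "2 * real (N div d) \<le> real (2 * N div d)" by linarith
    then show "0 \<le> mangoldt d * (real (2 * N div d) - 2 * real (N div d))"
      using mangoldt_nonneg[of d] by simp
  qed auto
  also have "\<dots> = ln (fact (2 * N)) - 2 * ln (fact N)"
    unfolding ln_fact_eq_sum_mangoldt ext by (simp add: algebra_simps sum_subtractf sum_distrib_left)
  also have "\<dots> = ln (real (2 * N choose N))"
  proof -
    have "fact (2 * N) = fact N * fact N * real (2 * N choose N)"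
      using binomial_fact_lemma[of N "2 * N"]
      by (metis (mono_tags, lifting) add_diff_cancel_left' le_add1 mult_2 of_nat_fact of_nat_mult)
    then show ?thesis by (simp add: ln_mult)
  qed
  also have "\<dots> \<le> ln (2 ^ (2 * N))"
    using binomial_le_pow2[of "2 * N" N]
    by (subst ln_le_cancel_iff) (auto simp del: of_nat_power simp: of_nat_le_numeral_power_cancel_iff zero_less_binomial)
  also have "\<dots> = 2 * real N * ln 2" by (simp add: ln_realpow)
  also have "\<dots> \<le> 2 * real N" using ln_le_minus_one[of "2::real"] by (simp add: mult_left_le)
  finally show ?thesis .
qed

lemma mangoldt_le_ln: "n > 0 \<Longrightarrow> mangoldt n \<le> ln (real n)"
proof -
  assume n: "n > 0"
  have "mangoldt n = (\<Sum>d\<in>{n}. mangoldt d :: real)" by simp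
  also have "\<dots> \<le> (\<Sum>d | d dvd n. mangoldt d)"
    using n mangoldt_nonneg by (intro sum_mono2) auto
  also have "\<dots> = ln (real n)" using n by (subst mangoldt_sum) auto
  finally show ?thesis .
qed

text \<open>Halving: for \<open>M = N div 2\<close> the induction hypothesis and the dyadic bound
  give \<open>4 M + 2 M\<close>, and for odd \<open>N\<close> the last term adds at most
  \<open>N\<close>.\<close>

lemma chebyshev_upper: "(\<Sum>d=1..N. mangoldt d) \<le> 4 * real N"
proof (induction N rule: less_induct)
  case (less N)
  show ?case
  proof (cases "N \<le> 1")
    case True
    then have "N = 0 \<or> N = 1" by auto
    then show ?thesis by auto
  next
    case False
    define M where "M = N div 2"
    have M: "M < N" using False by (simp add: M_def)
    have split: "{1..2 * M} = {1..M} \<union> {M<..2 * M}" by auto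
    have "(\<Sum>d=1..2 * M. mangoldt d) = (\<Sum>d=1..M. mangoldt d) + (\<Sum>d\<in>{M<..2 * M}. mangoldt d :: real)"
      unfolding split by (rule sum.union_disjoint) auto
    then have even: "(\<Sum>d=1..2 * M. mangoldt d) \<le> 6 * real M"
      using less.IH[OF M] sum_mangoldt_dyadic[of M] by linarith
    show ?thesis
    proof (cases "even N")
      case True
      then have "N = 2 * M" by (simp add: M_def)
      with even show ?thesis by simp
    next
      case False
      then have N: "N = Suc (2 * M)" by (simp add: M_def)
      have "mangoldt N \<le> real N"
        using mangoldt_le_ln[of N] ln_le_minus_one[of "real N"] N by simp
      then show ?thesis using even unfolding N by simp
    qed
  qed
qed

lemma nat_mult_ln_Suc_diff_le_1: "n > 0 \<Longrightarrow> real n * (ln (real (Suc n)) - ln (real n)) \<le> 1"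
proof -
  assume n: "n > 0"
  have "ln (real (Suc n)) - ln (real n) = ln (real (Suc n) / real n)"
    using n by (simp add: ln_div)
  also have "real (Suc n) / real n = 1 + 1 / real n" using n by (simp add: field_simps)
  also have "ln (1 + 1 / real n) \<le> 1 / real n" using n by (intro ln_add_one_self_le_self) simp
  finally show ?thesis using n by (simp add: field_simps)
qed

lemma ln_fact_lower: "N > 0 \<Longrightarrow> real N * ln (real N) - real N \<le> ln (fact N)"
proof (induction N rule: nat_induct_non_zero)
  case (Suc n)
  have "real (Suc n) * ln (real (Suc n)) - real (Suc n)
      = (real n * ln (real n) - real n) + ln (real (Suc n)) + (real n * (ln (real (Suc n)) - ln (real n)) - 1)"
    by (simp add: algebra_simps)
  also have "\<dots> \<le> ln (fact n) + ln (real (Suc n)) + 0"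
    using Suc nat_mult_ln_Suc_diff_le_1[of n] by (intro add_mono) auto
  also have "\<dots> = ln (fact (Suc n))" by (simp add: ln_mult)
  finally show ?case .
qed simp

text \<open>Dropping the floor in the formula for ln N! bounds it from above, to be compared with
  \<open>N ln N - N\<close>. This is the unbounded main term in the search for primes.\<close>

lemma mertens_lower:
  assumes "N > 0"
  shows "ln (real N) - 1 \<le> (\<Sum>d=1..N. mangoldt d / real d)"
proof -
  have "real N * ln (real N) - real N \<le> (\<Sum>d=1..N. mangoldt d * real (N div d))"
    using ln_fact_lower[OF assms] by (simp add: ln_fact_eq_sum_mangoldt)
  also have "\<dots> \<le> (\<Sum>d=1..N. mangoldt d * (real N / real d))"
    by (intro sum_mono mult_left_mono mangoldt_nonneg of_nat_div_le_of_nat)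
  also have "\<dots> = real N * (\<Sum>d=1..N. mangoldt d / real d)"
    by (simp add: sum_distrib_left mult_ac)
  finally have "real N * (ln (real N) - 1) \<le> real N * (\<Sum>d=1..N. mangoldt d / real d)"
    by (simp add: algebra_simps)
  then show ?thesis using assms by simp
qed

text \<open>Since \<open>ln n \<le> 2 sqrt n\<close>, a term is at most \<open>2 / n^(3/2)\<close>,
  hence at most \<open>4 / sqrt (n - 1) - 4 / sqrt n\<close>. The induction therefore carries the
  telescoped bound.\<close>

lemma sum_ln_over_square: "(\<Sum>n=2..N. ln (real n) / (real n)\<^sup>2) \<le> 4"
proof -
  have "(\<Sum>n=2..N. ln (real n) / (real n)\<^sup>2) \<le> 4 - 4 / sqrt (real N)" if "N \<ge> 1"
    using that
  proof (induction N rule: dec_induct)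
    case (step n)
    define a b where "a = sqrt (real n)" and "b = sqrt (real (Suc n))"
    have ab: "0 < a" "a \<le> b" "b\<^sup>2 - a\<^sup>2 = 1" "b\<^sup>2 = real (Suc n)"
      using step by (auto simp: a_def b_def)
    then have b: "b > 0" by linarith
    have "ln (real (Suc n)) = 2 * ln b" using b ab(4) by (metis ln_realpow of_nat_numeral)
    also have "\<dots> \<le> 2 * b" using ln_le_minus_one[OF b] by simp
    finally have "ln (real (Suc n)) / (real (Suc n))\<^sup>2 \<le> 2 * b / (b\<^sup>2)\<^sup>2"
      unfolding ab(4)[symmetric] by (intro divide_right_mono) auto
    also have "\<dots> = 2 / b ^ 3" using b by (simp add: field_simps eval_nat_numeral)
    also have "\<dots> \<le> 4 / (a * b * (a + b))"
    proof -
      have "a * b * (a + b) \<le> b * b * (b + b)" using ab b by (intro mult_mono add_mono) auto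
      then have "a * b * (a + b) \<le> 2 * b ^ 3" by (simp add: eval_nat_numeral algebra_simps)
      then have "4 / (2 * b ^ 3) \<le> 4 / (a * b * (a + b))" using ab b by (intro divide_left_mono) auto
      then show ?thesis by simp
    qed
    also have "\<dots> = 4 * (b\<^sup>2 - a\<^sup>2) / (a * b * (a + b))" using ab by simp
    also have "\<dots> = 4 * ((b - a) * (a + b)) / (a * b * (a + b))"
      by (simp add: power2_eq_square algebra_simps)
    also have "\<dots> = 4 * (b - a) / (a * b)" using ab b by simp
    also have "\<dots> = 4 / a - 4 / b" using ab b by (simp add: field_simps)
    finally show ?case using step unfolding a_def b_def by (simp add: sum.cl_ivl_Suc)
  qed simp
  then show ?thesis by (cases "N \<ge> 1") (auto intro: order.trans simp: not_le)
qed

text \<open>Bounded by a sum over all integers \<open>p \<ge> 2\<close> and exponents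
  \<open>k \<ge> 2\<close>. The geometric series in \<open>k\<close> is at most
  \<open>2 / p^2\<close>, which leads to 2 * 4.\<close>

lemma sum_mangoldt_proper_prime_powers:
  "(\<Sum>d | d \<in> {1..N} \<and> \<not> prime d. mangoldt d / real d) \<le> 8"
proof -
  define s where "s = {d \<in> {1..N}. primepow d \<and> \<not> prime d}"
  have geo: "(\<Sum>k=2..K. 1 / x ^ k) \<le> 2 / x\<^sup>2" if x: "x \<ge> 2" for x :: real and K
  proof -
    have "(\<Sum>k=2..K. 1 / x ^ k) \<le> 2 / x\<^sup>2 - 1 / x ^ K" if "K \<ge> 2" for K
      using that
    proof (induction K rule: dec_induct)
      case (step n)
      have "2 / x ^ Suc n \<le> 1 / x ^ n" using x by (simp add: field_simps)
      with step show ?case by (simp add: sum.cl_ivl_Suc)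
    qed simp
    from this[of K] show ?thesis using x by (cases "K \<ge> 2") (auto intro: order.trans simp: not_le)
  qed
  have "(\<Sum>d | d \<in> {1..N} \<and> \<not> prime d. mangoldt d / real d) = (\<Sum>d\<in>s. mangoldt d / real d)"
    unfolding s_def by (rule sum.mono_neutral_right) (auto simp: mangoldt_def)
  also have "\<dots> \<le> (\<Sum>(p, k)\<in>{2..N} \<times> {2..N}. ln (real p) / real p ^ k)"
  proof (rule sum_le_included[where i = "\<lambda>(p, k). p ^ k"])
    show "\<forall>d\<in>s. \<exists>y\<in>{2..N} \<times> {2..N}. (case y of (p, k) \<Rightarrow> p ^ k) = d
        \<and> mangoldt d / real d \<le> (case y of (p, k) \<Rightarrow> ln (real p) / real p ^ k)"
    proof
      fix d assume d: "d \<in> s"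
      then obtain p k where pk: "prime p" "k > 0" "d = p ^ k" by (auto simp: s_def primepow_def)
      have p: "p \<ge> 2" using prime_ge_2_nat[OF pk(1)] .
      have "k \<noteq> 1" using d pk by (auto simp: s_def)
      then have "k \<ge> 2" using pk by simp
      have "p ^ 1 \<le> p ^ k" using p pk by (intro power_increasing) auto
      then have "p \<le> N" using d pk by (simp add: s_def)
      have "k < 2 ^ k" by (rule less_exp)
      also have "2 ^ k \<le> p ^ k" using p by (intro power_mono) auto
      finally have "k \<le> N" using d pk by (simp add: s_def)
      then show "\<exists>y\<in>{2..N} \<times> {2..N}. (case y of (p, k) \<Rightarrow> p ^ k) = d
        \<and> mangoldt d / real d \<le> (case y of (p, k) \<Rightarrow> ln (real p) / real p ^ k)"
        using pk p \<open>k \<ge> 2\<close> \<open>p \<le> N\<close> by (intro bexI[of _ "(p, k)"]) auto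
    qed
  qed (auto simp: s_def)
  also have "\<dots> = (\<Sum>p=2..N. ln (real p) * (\<Sum>k=2..N. 1 / real p ^ k))"
    by (simp add: sum.cartesian_product[symmetric] sum_distrib_left)
  also have "\<dots> \<le> (\<Sum>p=2..N. ln (real p) * (2 / (real p)\<^sup>2))"
    by (intro sum_mono mult_left_mono geo) auto
  also have "\<dots> = 2 * (\<Sum>p=2..N. ln (real p) / (real p)\<^sup>2)"
    by (simp add: sum_distrib_left mult_ac)
  also have "\<dots> \<le> 8" using sum_ln_over_square[of N] by simp
  finally show ?thesis .
qed

section \<open>Primes with prescribed values of real characters\<close>

lemma geometric_sum_ge:
  fixes t :: real
  assumes "n > 0"
  shows "real n * t ^ (n - 1) \<le> (\<Sum>i<n. (t\<^sup>2) ^ i)"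
proof -
  \<comment> \<open>Arithmetic-geometric mean inequality for the terms \<open>i\<close> and
    \<open>n - 1 - i\<close>, whose product is \<open>t ^ (2 (n - 1))\<close>.\<close>
  have "2 * t ^ (n - 1) \<le> (t\<^sup>2) ^ i + (t\<^sup>2) ^ (n - Suc i)" if "i < n" for i
  proof -
    have "t ^ i * t ^ (n - Suc i) = t ^ (n - 1)" using that by (simp add: power_add[symmetric])
    moreover have "0 \<le> (t ^ i - t ^ (n - Suc i))\<^sup>2" by simp
    ultimately show ?thesis
      by (simp add: power2_diff power_mult[symmetric] mult.commute[of 2] mult.assoc)
  qed
  then have "(\<Sum>i<n. 2 * t ^ (n - 1)) \<le> (\<Sum>i<n. (t\<^sup>2) ^ i + (t\<^sup>2) ^ (n - Suc i))"
    by (intro sum_mono) auto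
  also have "\<dots> = 2 * (\<Sum>i<n. (t\<^sup>2) ^ i)"
    using sum.nat_diff_reindex[of "\<lambda>i. (t\<^sup>2) ^ i" n] by (simp add: sum.distrib)
  finally show ?thesis by simp
qed

context
  fixes q :: real and n :: nat
  assumes q: "0 < q" "q < 1" and n: "n > 0"
begin

text \<open>The q-analogue of \<open>k\<close>: up to the factor \<open>1 / (1 - q)\<close> the
  weights below become \<open>1 / n - q ^ n / G n\<close>.\<close>

private definition "G k = (\<Sum>i<k. q ^ i)"

private lemma one_diff_power: "1 - q ^ k = (1 - q) * G k"
  unfolding G_def by (induction k) (simp_all add: algebra_simps)

private lemma G_pos: "k > 0 \<Longrightarrow> G k > 0"
  unfolding G_def using q by (intro sum_pos) auto

private lemma G_ge: "k > 0 \<Longrightarrow> real k * sqrt q ^ (k - 1) \<le> G k"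
  using geometric_sum_ge[of k "sqrt q"] q by (simp add: G_def)

lemma lambert_weight_nonneg: "q ^ n / (1 - q ^ n) \<le> 1 / (real n * (1 - q))"
proof -
  have "real n * q ^ n = (\<Sum>i<n. q ^ n)" by simp
  also have "\<dots> \<le> G n" unfolding G_def using q by (intro sum_mono power_decreasing) auto
  finally have "q ^ n / G n \<le> 1 / real n" using n G_pos[OF n] by (simp add: field_simps)
  then have "q ^ n / G n / (1 - q) \<le> 1 / real n / (1 - q)" using q by (intro divide_right_mono) auto
  then show ?thesis by (simp add: one_diff_power mult.commute)
qed

text \<open>After cancelling \<open>1 - q\<close> the claim is
  \<open>q^n / (G n * G (n + 1)) \<le> 1 / (n (n + 1))\<close>. The bounds
  \<open>G k \<ge> k q^((k - 1) / 2)\<close> multiply to \<open>n (n + 1) q^(n - 1/2)\<close>, which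
  is enough since \<open>q < 1\<close>.\<close>

lemma lambert_weight_decreasing:
  "1 / (real (Suc n) * (1 - q)) - q ^ Suc n / (1 - q ^ Suc n)
     \<le> 1 / (real n * (1 - q)) - q ^ n / (1 - q ^ n)"
proof -
  define t where "t = sqrt q"
  have t: "0 < t" "t < 1" "q = t\<^sup>2" using q by (auto simp: t_def)
  have pos: "G n > 0" "G (Suc n) > 0" using n by (auto intro: G_pos)
  have "real n * real (Suc n) * q ^ n \<le> real n * real (Suc n) * t ^ (n - 1 + n)"
    using t by (intro mult_left_mono) (auto simp: power_mult[symmetric] intro!: power_decreasing)
  also have "\<dots> = (real n * t ^ (n - 1)) * (real (Suc n) * t ^ n)" by (simp add: power_add)
  also have "\<dots> \<le> G n * G (Suc n)"
    using G_ge[of n] G_ge[of "Suc n"] n t pos unfolding t_def by (intro mult_mono) auto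
  finally have "q ^ n / (G n * G (Suc n)) \<le> 1 / (real n * real (Suc n))"
    using n pos by (simp add: pos_divide_le_eq pos_le_divide_eq mult.commute del: of_nat_Suc)
  moreover have "q ^ n / (G n * G (Suc n)) = q ^ n / G n - q ^ Suc n / G (Suc n)"
  proof -
    have "G (Suc n) = 1 + q * G n"
      using one_diff_power[of n] one_diff_power[of "Suc n"] q by (simp add: G_def algebra_simps)
    then have "q ^ n * G (Suc n) - q ^ Suc n * G n = q ^ n" by (simp add: algebra_simps)
    then show ?thesis using pos by (simp add: diff_frac_eq)
  qed
  moreover have "1 / (real n * real (Suc n)) = 1 / real n - 1 / real (Suc n)"
    using n by (simp add: field_simps)
  ultimately have "1 / real (Suc n) - q ^ Suc n / G (Suc n) \<le> 1 / real n - q ^ n / G n" by linarith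
  then have "(1 / real (Suc n) - q ^ Suc n / G (Suc n)) / (1 - q) \<le> (1 / real n - q ^ n / G n) / (1 - q)"
    using q by (intro divide_right_mono) auto
  then show ?thesis unfolding one_diff_power by (simp add: diff_divide_distrib mult.commute)
qed

end

section \<open>Real characters and the non-vanishing of L(1, \<chi>)\<close>

locale real_character =
  fixes \<chi> :: "nat \<Rightarrow> real" and C :: real
  assumes one [simp]: "\<chi> 1 = 1"
    and mult: "\<chi> (a * b) = \<chi> a * \<chi> b"
    and vals: "\<chi> n \<in> {-1, 0, 1}"
    and sum_bounded: "\<bar>\<Sum>n=1..N. \<chi> n\<bar> \<le> C"
begin

lemma bound_nonneg: "C \<ge> 0"
  using sum_bounded[of 0] by simp

lemma abs_le_1: "\<bar>\<chi> n\<bar> \<le> 1"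
  using vals[of n] by auto

text \<open>Summation by parts of a bounded character sum against the decreasing weight
  \<open>1 / n\<close>; this gives convergence of the series with an explicit rate.\<close>

lemma tail_bound:
  assumes "M \<le> N"
  shows "\<bar>(\<Sum>n=1..N. \<chi> n / real n) - (\<Sum>n=1..M. \<chi> n / real n)\<bar> \<le> 2 * C / real (Suc M)"
proof -
  have split: "{1..N} = {1..M} \<union> {M<..N}" using assms by auto
  have "(\<Sum>n=1..N. \<chi> n / real n) = (\<Sum>n=1..M. \<chi> n / real n) + (\<Sum>n\<in>{M<..N}. \<chi> n / real n)"
    unfolding split by (rule sum.union_disjoint) auto
  then show ?thesis
    using abel_summation_bound_tail[of \<chi> C M "\<lambda>n. 1 / real n" N] sum_bounded
    by (simp add: frac_le)
qed

definition L :: real where "L = lim (\<lambda>N. \<Sum>n=1..N. \<chi> n / real n)"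

lemma L_tendsto: "(\<lambda>N. \<Sum>n=1..N. \<chi> n / real n) \<longlonglongrightarrow> L"
proof -
  define S where "S N = (\<Sum>n=1..N. \<chi> n / real n)" for N
  have "Cauchy S"
  proof (rule CauchyI)
    fix e :: real assume "e > 0"
    obtain M where M: "4 * C / e < real M" using reals_Archimedean2 by blast
    then have "4 * C < e * real (Suc M)" using \<open>e > 0\<close> by (simp add: field_simps)
    then have small: "2 * C / real (Suc M) < e / 2" by (simp add: field_simps)
    have "norm (S m - S n) < e" if "m \<ge> M" "n \<ge> M" for m n
      using tail_bound[OF that(1)] tail_bound[OF that(2)] small unfolding S_def real_norm_def by linarith
    then show "\<exists>M. \<forall>m\<ge>M. \<forall>n\<ge>M. norm (S m - S n) < e" by blast
  qed
  then show ?thesis unfolding L_def S_def by (simp add: Cauchy_convergent_iff convergent_LIMSEQ_iff)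
qed

lemma L_approx: "\<bar>(\<Sum>n=1..M. \<chi> n / real n) - L\<bar> \<le> 2 * C / real (Suc M)"
proof (rule tendsto_upperbound)
  show "(\<lambda>N. \<bar>(\<Sum>n=1..M. \<chi> n / real n) - (\<Sum>n=1..N. \<chi> n / real n)\<bar>) \<longlonglongrightarrow>
    \<bar>(\<Sum>n=1..M. \<chi> n / real n) - L\<bar>"
    by (intro tendsto_intros L_tendsto)
  show "\<forall>\<^sub>F N in sequentially.
    \<bar>(\<Sum>n=1..M. \<chi> n / real n) - (\<Sum>n=1..N. \<chi> n / real n)\<bar> \<le> 2 * C / real (Suc M)"
    using eventually_ge_at_top[of M] by eventually_elim (metis tail_bound abs_minus_commute)
qed simp

text \<open>These are the partial sums of -L'(1, \<chi>). Summation by parts starts at 3, where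
  \<open>ln n \<ge> 1\<close> makes \<open>ln n / n\<close> decrease; the first two terms are
  bounded separately.\<close>

lemma sum_ln_bounded: "\<exists>K. \<forall>N. \<bar>\<Sum>n=1..N. \<chi> n / real n * ln (real n)\<bar> \<le> K"
proof -
  define f where "f n = \<chi> n * (ln (real n) / real n)" for n
  define b where "b = (\<lambda>n. ln (real n) / real n)"
  have dec: "b (Suc n) \<le> b n" if "n > 2" for n
  proof -
    have "1 \<le> ln (real n)"
      using that exp_le by (subst ln_ge_iff) auto
    then have "real n * ln (real (Suc n)) \<le> real (Suc n) * ln (real n)"
      using nat_mult_ln_Suc_diff_le_1[of n] that by (simp add: algebra_simps)
    then show ?thesis using that unfolding b_def by (simp add: field_simps)
  qed
  have "\<bar>\<Sum>n=1..N. f n\<bar> \<le> \<bar>f 1\<bar> + \<bar>f 2\<bar> + 2 * C * b 3" for N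
  proof -
    have tail: "\<bar>\<Sum>n\<in>{2<..N}. f n\<bar> \<le> 2 * C * b 3"
      using abel_summation_bound_tail[of \<chi> C 2 b N, OF sum_bounded dec]
      unfolding f_def b_def by (simp add: numeral_3_eq_3)
    have "0 \<le> 2 * C * b 3" using bound_nonneg by (simp add: b_def)
    consider "N = 0" | "N = 1" | "N \<ge> 2" by linarith
    then show ?thesis
    proof cases
      case 3
      then have "{1..N} = {1, 2} \<union> {2<..N}" by auto
      then have "(\<Sum>n=1..N. f n) = (\<Sum>n\<in>{1, 2}. f n) + (\<Sum>n\<in>{2<..N}. f n)"
        by (simp only:) (rule sum.union_disjoint, auto)
      then have "(\<Sum>n=1..N. f n) = f 1 + f 2 + (\<Sum>n\<in>{2<..N}. f n)" by simp
      then show ?thesis using tail by linarith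
    qed (use \<open>0 \<le> 2 * C * b 3\<close> in auto)
  qed
  then show ?thesis unfolding f_def by (auto simp: mult.commute)
qed

text \<open>Mertens' argument: expanding the logarithm in the sum of
  \<open>\<chi> n ln n / n\<close> yields the sum of
  \<open>mangoldt d * \<chi> d / d * S (N div d)\<close>. Replacing \<open>S (N div d)\<close> by
  \<open>L\<close> costs at most \<open>2 C / N\<close> times the sum of \<open>mangoldt d\<close>,
  hence at most \<open>8 C\<close> by Chebyshev's bound.\<close>

lemma L_mult_sum_mangoldt_bounded:
  "\<exists>K. \<forall>N. \<bar>L * (\<Sum>d=1..N. mangoldt d * \<chi> d / real d)\<bar> \<le> K"
proof -
  obtain K where K: "\<And>N. \<bar>\<Sum>n=1..N. \<chi> n / real n * ln (real n)\<bar> \<le> K"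
    using sum_ln_bounded by blast
  have "\<bar>L * (\<Sum>d=1..N. mangoldt d * \<chi> d / real d)\<bar> \<le> K + 8 * C" for N
  proof (cases "N = 0")
    case True
    then show ?thesis using K[of 0] bound_nonneg by simp
  next
    case False
    define S where "S M = (\<Sum>n=1..M. \<chi> n / real n)" for M
    have eq: "(\<Sum>n=1..N. \<chi> n / real n * ln (real n))
        = (\<Sum>d=1..N. mangoldt d * \<chi> d / real d * S (N div d))"
      unfolding sum_mult_ln_eq_sum_mangoldt S_def by (simp add: mult sum_distrib_left mult_ac)
    have "\<bar>(\<Sum>d=1..N. mangoldt d * \<chi> d / real d * S (N div d))
        - L * (\<Sum>d=1..N. mangoldt d * \<chi> d / real d)\<bar>
        = \<bar>\<Sum>d=1..N. mangoldt d * \<chi> d / real d * (S (N div d) - L)\<bar>"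
      by (simp add: sum_distrib_left sum_subtractf[symmetric] right_diff_distrib mult.commute[of _ L])
    also have "\<dots> \<le> (\<Sum>d=1..N. mangoldt d * (2 * C / real N))"
    proof (rule order.trans[OF sum_abs sum_mono])
      fix d assume d: "d \<in> {1..N}"
      have "N < d * Suc (N div d)" using d by (simp add: dividend_less_times_div)
      then have "real N \<le> real d * real (Suc (N div d))" by (metis less_imp_le of_nat_le_iff of_nat_mult)
      then have "1 / real (Suc (N div d)) \<le> real d / real N" using False by (simp add: field_simps)
      then have "2 * C * (1 / real (Suc (N div d))) \<le> 2 * C * (real d / real N)"
        using bound_nonneg by (intro mult_left_mono) auto
      then have S: "\<bar>S (N div d) - L\<bar> \<le> 2 * C * (real d / real N)"
        using L_approx[of "N div d"] unfolding S_def by simp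
      have "\<bar>mangoldt d * \<chi> d / real d * (S (N div d) - L)\<bar>
          = mangoldt d / real d * (\<bar>\<chi> d\<bar> * \<bar>S (N div d) - L\<bar>)"
        by (simp add: abs_mult mangoldt_nonneg)
      also have "\<dots> \<le> mangoldt d / real d * (1 * (2 * C * (real d / real N)))"
        using S abs_le_1 by (intro mult_left_mono mult_mono) (auto simp: mangoldt_nonneg)
      finally show "\<bar>mangoldt d * \<chi> d / real d * (S (N div d) - L)\<bar> \<le> mangoldt d * (2 * C / real N)"
        using d by simp
    qed
    also have "\<dots> = 2 * C / real N * (\<Sum>d=1..N. mangoldt d)"
      by (subst sum_distrib_right[symmetric]) (rule mult.commute)
    also have "\<dots> \<le> 2 * C / real N * (4 * real N)"
      using chebyshev_upper bound_nonneg by (intro mult_left_mono) auto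
    also have "\<dots> = 8 * C" using False by simp
    finally show ?thesis using K[of N] unfolding eq by linarith
  qed
  then show ?thesis by blast
qed

text \<open>A divisor of \<open>a * b\<close> factors uniquely into a divisor of \<open>a\<close>
  and one of \<open>b\<close>. This reduces the sign of divisor sums to prime powers.\<close>

lemma sum_divisors_mult_coprime:
  assumes "coprime a b"
  shows "(\<Sum>d | d dvd a * b. \<chi> d) = (\<Sum>d | d dvd a. \<chi> d) * (\<Sum>d | d dvd b. \<chi> d)"
proof -
  have inj: "inj_on (\<lambda>(d, e). d * e) ({d. d dvd a} \<times> {e. e dvd b})"
  proof (rule inj_onI, clarify)
    fix d e d' e'
    assume *: "d dvd a" "e dvd b" "d' dvd a" "e' dvd b" "d * e = d' * e'"
    have cop: "coprime d e'" "coprime d' e" "coprime e d'" "coprime e' d"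
      using * assms by (meson coprime_divisors coprime_commute)+
    have "d dvd d' * e'" "d' dvd d * e" using *(5) by (metis dvd_triv_left)+
    then have "d dvd d'" "d' dvd d"
      using cop by (simp_all add: coprime_dvd_mult_left_iff)
    then have "d = d'" by (rule dvd_antisym)
    have "e dvd e' * d'" "e' dvd e * d" using *(5) by (metis dvd_triv_right mult.commute)+
    then have "e dvd e'" "e' dvd e"
      using cop by (simp_all add: coprime_dvd_mult_left_iff)
    then show "d = d' \<and> e = e'" using \<open>d = d'\<close> dvd_antisym by blast
  qed
  have img: "{d. d dvd a * b} = (\<lambda>(d, e). d * e) ` ({d. d dvd a} \<times> {e. e dvd b})"
  proof (intro equalityI subsetI)
    fix x assume "x \<in> {d. d dvd a * b}"
    then obtain d e where "x = d * e" "d dvd a" "e dvd b" using dvd_productE by blast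
    then show "x \<in> (\<lambda>(d, e). d * e) ` ({d. d dvd a} \<times> {e. e dvd b})"
      by (intro image_eqI[of _ _ "(d, e)"]) simp_all
  qed (clarsimp simp: mult_dvd_mono)
  have "(\<Sum>d | d dvd a * b. \<chi> d) = (\<Sum>(d, e)\<in>{d. d dvd a} \<times> {e. e dvd b}. \<chi> d * \<chi> e)"
    unfolding img by (subst sum.reindex[OF inj]) (simp add: case_prod_unfold mult)
  also have "\<dots> = (\<Sum>d | d dvd a. \<chi> d) * (\<Sum>d | d dvd b. \<chi> d)"
    by (simp add: sum_product sum.cartesian_product)
  finally show ?thesis .
qed

lemma power: "\<chi> (a ^ k) = \<chi> a ^ k"
  using one by (induction k) (simp_all add: mult)

text \<open>The sum is \<open>1 + \<chi> p + ... + \<chi> p ^ k\<close>. For \<open>\<chi> p\<close>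
  equal to 1, 0, -1 this is \<open>k + 1\<close>, 1, and alternately 1 and 0.\<close>

lemma sum_divisors_prime_power:
  assumes "prime p"
  shows "0 \<le> (\<Sum>d | d dvd p ^ k. \<chi> d)" and "even k \<Longrightarrow> 1 \<le> (\<Sum>d | d dvd p ^ k. \<chi> d)"
proof -
  have "{d. d dvd p ^ k} = (\<lambda>j. p ^ j) ` {..k}"
    using divides_primepow_nat[OF assms] by auto
  moreover have "inj_on (\<lambda>j. p ^ j) {..k}"
    using prime_gt_1_nat[OF assms] by (auto intro!: inj_onI)
  ultimately have eq: "(\<Sum>d | d dvd p ^ k. \<chi> d) = (\<Sum>j\<le>k. \<chi> p ^ j)"
    by (simp add: sum.reindex power)
  have alt: "(\<Sum>j\<le>k. (-1) ^ j) = (if even k then 1 else 0 :: real)"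
    by (induction k) auto
  have zero: "(\<Sum>j\<le>k. 0 ^ j) = (1 :: real)"
    by (induction k) auto
  consider "\<chi> p = -1" | "\<chi> p = 0" | "\<chi> p = 1" using vals[of p] by auto
  then have "0 \<le> (\<Sum>j\<le>k. \<chi> p ^ j) \<and> (even k \<longrightarrow> 1 \<le> (\<Sum>j\<le>k. \<chi> p ^ j))"
    by cases (simp_all add: alt zero)
  then show "0 \<le> (\<Sum>d | d dvd p ^ k. \<chi> d)" and "even k \<Longrightarrow> 1 \<le> (\<Sum>d | d dvd p ^ k. \<chi> d)"
    unfolding eq by auto
qed

text \<open>Splits off the full power of one prime at a time; in \<open>n^2\<close> all exponents
  are even, so every local factor is at least 1.\<close>

lemma sum_divisors_nonneg_square:
  assumes "n > 0"
  shows "0 \<le> (\<Sum>d | d dvd n. \<chi> d) \<and> 1 \<le> (\<Sum>d | d dvd n\<^sup>2. \<chi> d)"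
  using assms
proof (induction n rule: less_induct)
  case (less n)
  show ?case
  proof (cases "n = 1")
    case True
    then show ?thesis using one by simp
  next
    case False
    then obtain p where p: "prime p" "p dvd n" using prime_factor_nat by blast
    define k where "k = multiplicity p n"
    obtain m where m: "n = p ^ k * m" "\<not> p dvd m"
      using multiplicity_decompose'[of n p] less.prems p unfolding k_def
      by (metis not_prime_unit less_irrefl)
    have "k > 0" using p m by (cases k) auto
    then have "p ^ k > 1" using prime_gt_1_nat[OF p(1)] by (intro one_less_power) auto
    moreover have "m > 0" using m less.prems by (cases m) auto
    ultimately have "m < n" using m by simp
    note IH = less.IH[OF this \<open>m > 0\<close>]
    have "coprime (p ^ k) m" using p m by (simp add: prime_imp_coprime)
    moreover have "coprime (p ^ (2 * k)) (m\<^sup>2)" using p m by (simp add: prime_imp_coprime)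
    moreover have "n\<^sup>2 = p ^ (2 * k) * m\<^sup>2"
      using m by (simp add: power_mult_distrib power_mult[symmetric] mult.commute)
    ultimately have
      eq: "(\<Sum>d | d dvd n. \<chi> d) = (\<Sum>d | d dvd p ^ k. \<chi> d) * (\<Sum>d | d dvd m. \<chi> d)"
      "(\<Sum>d | d dvd n\<^sup>2. \<chi> d) = (\<Sum>d | d dvd p ^ (2 * k). \<chi> d) * (\<Sum>d | d dvd m\<^sup>2. \<chi> d)"
      using sum_divisors_mult_coprime m(1) by metis+
    have "1 * 1 \<le> (\<Sum>d | d dvd p ^ (2 * k). \<chi> d) * (\<Sum>d | d dvd m\<^sup>2. \<chi> d)"
      using IH sum_divisors_prime_power(2)[OF p(1), of "2 * k"] by (intro mult_mono) auto
    then show ?thesis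
      using IH sum_divisors_prime_power(1)[OF p(1), of k] unfolding eq by simp
  qed
qed

text \<open>Exchanging the sums produces a truncated Lambert series with weights
  \<open>q^d / (1 - q^d)\<close>. Their difference \<open>b\<close> from
  \<open>1 / (d (1 - q))\<close> is decreasing and non-negative, so summation by parts bounds its
  contribution by \<open>2 C * b 1 = 2 C\<close>.\<close>

lemma sum_divisors_power_series_bound:
  fixes q :: real
  assumes q: "0 < q" "q < 1" and N: "N > 0"
  shows "(\<Sum>n=1..N. (\<Sum>d | d dvd n. \<chi> d) * q ^ n)
    \<le> 2 * C + \<bar>\<Sum>n=1..N. \<chi> n / real n\<bar> / (1 - q) + real N * q ^ N / (1 - q)"
proof -
  define b where "b n = 1 / (real n * (1 - q)) - q ^ n / (1 - q ^ n)" for n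
  have pos: "0 < 1 - q ^ d" if "d > 0" for d
    using q that by (simp add: power_less_one_iff)
  have "(\<Sum>n=1..N. (\<Sum>d | d dvd n. \<chi> d) * q ^ n) = (\<Sum>n=1..N. \<Sum>d | d dvd n. \<chi> d * q ^ n)"
    by (simp add: sum_distrib_right)
  also have "\<dots> = (\<Sum>d=1..N. \<chi> d * (\<Sum>k=1..N div d. (q ^ d) ^ k))"
    by (subst sum_divisors_swap) (simp add: sum_distrib_left power_mult)
  \<comment> \<open>Completing the geometric series in \<open>k\<close> adds terms whose exponents
    start at \<open>d (N div d + 1) \<ge> N\<close>, hence an error of at most
    \<open>q^N / (1 - q)\<close> for each \<open>d\<close>.\<close>
  also have "\<dots> \<le> (\<Sum>d=1..N. \<chi> d * (q ^ d / (1 - q ^ d)) + q ^ N / (1 - q))"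
  proof (rule sum_mono)
    fix d assume d: "d \<in> {1..N}"
    define x K where "x = q ^ d" and "K = N div d"
    have "(\<Sum>k=1..K. x ^ k) * (1 - x) = x - x ^ Suc K"
    proof (induction K)
      case (Suc K)
      have "(\<Sum>k=1..Suc K. x ^ k) * (1 - x) = (\<Sum>k=1..K. x ^ k) * (1 - x) + x ^ Suc K * (1 - x)"
        by (simp add: distrib_right)
      also have "\<dots> = x - x ^ Suc K + x ^ Suc K * (1 - x)" by (simp only: Suc.IH)
      also have "\<dots> = x - x ^ Suc (Suc K)" by (simp add: algebra_simps)
      finally show ?case .
    qed simp
    then have "(\<Sum>k=1..K. x ^ k) = x / (1 - x) - x ^ Suc K / (1 - x)"
      using pos[of d] d by (simp add: x_def diff_divide_distrib[symmetric] eq_divide_eq)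
    moreover have "x ^ Suc K / (1 - x) \<le> q ^ N / (1 - q)"
    proof (rule frac_le)
      have "N \<le> d * Suc K" using d dividend_less_times_div[of d N] by (simp add: K_def)
      then have "q ^ (d * Suc K) \<le> q ^ N" using q by (intro power_decreasing) auto
      then show "x ^ Suc K \<le> q ^ N" unfolding x_def power_mult .
      have "q ^ d \<le> q ^ 1" using q d by (intro power_decreasing) auto
      then show "1 - q \<le> 1 - x" by (simp add: x_def)
    qed (use q in auto)
    moreover have "\<chi> d * (x / (1 - x) - y) \<le> \<chi> d * (x / (1 - x)) + y" if "y \<ge> 0" for y
    proof -
      have "- \<chi> d * y \<le> 1 * y" using abs_le_1[of d] that by (intro mult_right_mono) auto
      then show ?thesis by (simp add: algebra_simps)
    qed
    moreover have "x ^ Suc K / (1 - x) \<ge> 0" using pos[of d] d q by (simp add: x_def)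
    ultimately have "\<chi> d * (\<Sum>k=1..K. x ^ k) \<le> \<chi> d * (x / (1 - x)) + q ^ N / (1 - q)"
      by fastforce
    then show "\<chi> d * (\<Sum>k=1..N div d. (q ^ d) ^ k)
        \<le> \<chi> d * (q ^ d / (1 - q ^ d)) + q ^ N / (1 - q)"
      unfolding x_def K_def .
  qed
  also have "\<dots> = (\<Sum>d=1..N. \<chi> d * (q ^ d / (1 - q ^ d))) + real N * q ^ N / (1 - q)"
    by (simp add: sum.distrib)
  also have "(\<Sum>d=1..N. \<chi> d * (q ^ d / (1 - q ^ d)))
      = (\<Sum>n=1..N. \<chi> n / real n) / (1 - q) - (\<Sum>d=1..N. \<chi> d * b d)"
    by (simp add: b_def sum_divide_distrib sum_subtractf[symmetric] algebra_simps)
  finally have main: "(\<Sum>n=1..N. (\<Sum>d | d dvd n. \<chi> d) * q ^ n)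
    \<le> (\<Sum>n=1..N. \<chi> n / real n) / (1 - q) - (\<Sum>d=1..N. \<chi> d * b d)
      + real N * q ^ N / (1 - q)" .
  have "\<bar>\<Sum>d=1..N. \<chi> d * b d\<bar> \<le> 2 * C"
  proof -
    have dec: "b (Suc n) \<le> b n \<and> 0 \<le> b n" if "n > 0" for n
      using lambert_weight_decreasing[OF q that] lambert_weight_nonneg[OF q that] unfolding b_def by simp
    have "{0<..N} = {1..N}" by auto
    then have "\<bar>\<Sum>d=1..N. \<chi> d * b d\<bar> \<le> 2 * C * b 1"
      using abel_summation_bound_tail[of \<chi> C 0 b N, OF sum_bounded] dec by simp
    also have "b 1 = 1" using q by (simp add: b_def field_simps)
    finally show ?thesis by simp
  qed
  then have "- (\<Sum>d=1..N. \<chi> d * b d) \<le> 2 * C" by linarith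
  moreover have "(\<Sum>n=1..N. \<chi> n / real n) / (1 - q) \<le> \<bar>\<Sum>n=1..N. \<chi> n / real n\<bar> / (1 - q)"
    using q by (intro divide_right_mono) auto
  ultimately show ?thesis using main by linarith
qed

text \<open>If \<open>L = 0\<close>, the previous bound tends to \<open>2 C\<close> as \<open>N \<rightarrow> \<infinity>\<close>, while the squares alone contribute
  \<open>\<Sum> q ^ k\<^sup>2\<close>, which is unbounded as \<open>q \<rightarrow> 1\<close>.\<close>

lemma L_nonzero: "L \<noteq> 0"
proof
  assume L0: "L = 0"
  define r where "r n = (\<Sum>d | d dvd n. \<chi> d)" for n
  have bound: "(\<Sum>k=1..K. q ^ k\<^sup>2) \<le> 2 * C" if q: "0 < q" "q < 1" for q :: real and K :: nat
  proof (rule tendsto_lowerbound)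
    have "(\<lambda>N. 2 * C + \<bar>\<Sum>n=1..N. \<chi> n / real n\<bar> / (1 - q) + real N * q ^ N / (1 - q))
        \<longlonglongrightarrow> 2 * C + \<bar>L\<bar> / (1 - q) + 0 / (1 - q)"
      using q by (intro tendsto_intros L_tendsto powser_times_n_limit_0) auto
    then show "(\<lambda>N. 2 * C + \<bar>\<Sum>n=1..N. \<chi> n / real n\<bar> / (1 - q) + real N * q ^ N / (1 - q))
        \<longlonglongrightarrow> 2 * C"
      by (simp add: L0)
    show "\<forall>\<^sub>F N in sequentially. (\<Sum>k=1..K. q ^ k\<^sup>2)
        \<le> 2 * C + \<bar>\<Sum>n=1..N. \<chi> n / real n\<bar> / (1 - q) + real N * q ^ N / (1 - q)"
      \<comment> \<open>\<open>N > K^2\<close> keeps all the squares \<open>k^2\<close> with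
        \<open>k \<le> K\<close> in range and makes \<open>N\<close> positive.\<close>
      using eventually_ge_at_top[of "Suc (K\<^sup>2)"]
    proof eventually_elim
      case (elim N)
      have inj: "inj_on (\<lambda>k::nat. k\<^sup>2) {1..K}" by (rule inj_onI) simp
      have "(\<Sum>k=1..K. q ^ k\<^sup>2) \<le> (\<Sum>k=1..K. r (k\<^sup>2) * q ^ k\<^sup>2)"
        using sum_divisors_nonneg_square q unfolding r_def
        by (intro sum_mono) (simp add: mult_le_cancel_right1)
      also have "\<dots> = (\<Sum>n\<in>(\<lambda>k. k\<^sup>2) ` {1..K}. r n * q ^ n)"
        by (subst sum.reindex[OF inj]) simp
      also have "\<dots> \<le> (\<Sum>n=1..N. r n * q ^ n)"
      proof (rule sum_mono2)
        show "(\<lambda>k. k\<^sup>2) ` {1..K} \<subseteq> {1..N}"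
        proof clarify
          fix k assume "k \<in> {1..K}"
          then have "k\<^sup>2 \<le> K\<^sup>2" "1 \<le> k\<^sup>2" by (auto intro: power_mono)
          then show "k\<^sup>2 \<in> {1..N}" using elim unfolding atLeastAtMost_iff by linarith
        qed
        show "0 \<le> r n * q ^ n" if "n \<in> {1..N} - (\<lambda>k. k\<^sup>2) ` {1..K}" for n
          using that sum_divisors_nonneg_square[of n] q by (simp add: r_def)
      qed simp
      also have "\<dots> \<le> 2 * C + \<bar>\<Sum>n=1..N. \<chi> n / real n\<bar> / (1 - q) + real N * q ^ N / (1 - q)"
        unfolding r_def using elim q by (intro sum_divisors_power_series_bound) auto
      finally show ?case .
    qed
  qed simp
  obtain K :: nat where K: "2 * C < real K" using reals_Archimedean2 by blast
  \<comment> \<open>With \<open>K\<close> fixed, let \<open>q\<close> tend to 1 from below: each of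
    the \<open>K\<close> terms tends to 1.\<close>
  have "real K \<le> 2 * C"
  proof (rule tendsto_upperbound)
    have "((\<lambda>q::real. \<Sum>k=1..K. q ^ k\<^sup>2) \<longlongrightarrow> (\<Sum>k=1..K. 1 ^ k\<^sup>2)) (at_left 1)"
      by (intro tendsto_intros)
    then show "((\<lambda>q::real. \<Sum>k=1..K. q ^ k\<^sup>2) \<longlongrightarrow> real K) (at_left 1)" by simp
    show "\<forall>\<^sub>F q :: real in at_left 1. (\<Sum>k=1..K. q ^ k\<^sup>2) \<le> 2 * C"
      using eventually_at_left_real[OF zero_less_one] by eventually_elim (rule bound, auto)
  qed simp
  with K show False by simp
qed

lemma sum_mangoldt_bounded: "\<exists>K. \<forall>N. \<bar>\<Sum>d=1..N. mangoldt d * \<chi> d / real d\<bar> \<le> K"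
proof -
  obtain K where K: "\<And>N. \<bar>L * (\<Sum>d=1..N. mangoldt d * \<chi> d / real d)\<bar> \<le> K"
    using L_mult_sum_mangoldt_bounded by blast
  then have "\<bar>\<Sum>d=1..N. mangoldt d * \<chi> d / real d\<bar> \<le> K / \<bar>L\<bar>" for N
    using L_nonzero by (simp add: abs_mult field_simps)
  then show ?thesis by blast
qed

end

text \<open>If no prime had the prescribed values, the non-negative weight \<open>w\<close> would
  vanish at all unramified primes, and the sum of \<open>mangoldt d * w d / d\<close>, fed only by
  ramified primes and proper prime powers, would be bounded. Expanding \<open>w\<close> over subsets
  \<open>J\<close> contradicts this: the empty set contributes at least \<open>ln N - 1\<close>, the
  others, by the independence expressed in \<open>char\<close>, bounded sums.\<close>

theorem prime_with_character_values:
  fixes \<chi> :: "'i \<Rightarrow> nat \<Rightarrow> real" and \<epsilon> :: "'i \<Rightarrow> real"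
  assumes I: "finite I"
    and char: "\<And>J. J \<subseteq> I \<Longrightarrow> J \<noteq> {} \<Longrightarrow> \<exists>C. real_character (\<lambda>n. \<Prod>i\<in>J. \<chi> i n) C"
    and \<epsilon>: "\<And>i. i \<in> I \<Longrightarrow> \<epsilon> i \<in> {-1, 1}"
    and ramified: "finite {p. prime p \<and> (\<exists>i\<in>I. \<chi> i p = 0)}"
  shows "\<exists>p. prime p \<and> (\<forall>i\<in>I. \<chi> i p = \<epsilon> i)"
proof (rule ccontr)
  assume none: "\<not> ?thesis"
  define Z where "Z = {p. prime p \<and> (\<exists>i\<in>I. \<chi> i p = 0)}"
  define w where "w d = (\<Prod>i\<in>I. 1 + \<epsilon> i * \<chi> i d)" for d
  define B :: real where "B = 2 ^ card I"
  have vals: "\<chi> i n \<in> {-1, 0, 1}" if "i \<in> I" for i n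
    using char[of "{i}"] that real_character.vals by fastforce
  have factor: "0 \<le> 1 + \<epsilon> i * \<chi> i d \<and> 1 + \<epsilon> i * \<chi> i d \<le> 2" if "i \<in> I" for i d
    using vals[OF that, of d] \<epsilon>[OF that] by auto
  have w: "0 \<le> w d" "w d \<le> B" for d
  proof -
    show "0 \<le> w d" unfolding w_def using factor by (intro prod_nonneg) auto
    have "w d \<le> (\<Prod>i\<in>I. 2)" unfolding w_def using factor by (intro prod_mono) auto
    then show "w d \<le> B" by (simp add: B_def)
  qed
  have w_prime: "w p = 0" if p: "prime p" "p \<notin> Z" for p
  proof -
    obtain i where i: "i \<in> I" "\<chi> i p \<noteq> \<epsilon> i" using none p by blast
    then have "\<chi> i p = - \<epsilon> i" using vals[OF i(1), of p] \<epsilon>[OF i(1)] p by (auto simp: Z_def)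
    then have "1 + \<epsilon> i * \<chi> i p = 0" using \<epsilon>[OF i(1)] by auto
    then show ?thesis unfolding w_def using I i(1) by (metis prod_zero)
  qed
  have upper: "(\<Sum>d=1..N. mangoldt d * w d / real d) \<le> B * 8 + B * (\<Sum>p\<in>Z. ln (real p))" for N
  proof -
    define P where "P = {d. d \<in> {1..N} \<and> prime d}"
    define Q where "Q = {d. d \<in> {1..N} \<and> \<not> prime d}"
    have split: "{1..N} = Q \<union> P" by (auto simp: P_def Q_def)
    have "(\<Sum>d=1..N. mangoldt d * w d / real d)
        = (\<Sum>d\<in>Q. mangoldt d * w d / real d) + (\<Sum>d\<in>P. mangoldt d * w d / real d)"
      unfolding split by (rule sum.union_disjoint) (auto simp: P_def Q_def)
    also have "(\<Sum>d\<in>Q. mangoldt d * w d / real d) \<le> (\<Sum>d\<in>Q. B * (mangoldt d / real d))"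
    proof (rule sum_mono)
      fix d
      have "mangoldt d * w d \<le> mangoldt d * B" using w mangoldt_nonneg by (intro mult_left_mono)
      then have "mangoldt d * w d / real d \<le> mangoldt d * B / real d" by (intro divide_right_mono) auto
      then show "mangoldt d * w d / real d \<le> B * (mangoldt d / real d)" by (simp add: mult.commute)
    qed
    also have "\<dots> = B * (\<Sum>d\<in>Q. mangoldt d / real d)" by (simp add: sum_distrib_left)
    also have "\<dots> \<le> B * 8"
      unfolding Q_def using sum_mangoldt_proper_prime_powers by (intro mult_left_mono) (auto simp: B_def)
    also have "(\<Sum>d\<in>P. mangoldt d * w d / real d) = (\<Sum>d\<in>P \<inter> Z. mangoldt d * w d / real d)"
      by (rule sum.mono_neutral_right) (auto simp: P_def w_prime)
    also have "\<dots> \<le> (\<Sum>p\<in>P \<inter> Z. B * ln (real p))"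
    proof (rule sum_mono)
      fix p assume "p \<in> P \<inter> Z"
      then have p: "p \<ge> 1" "prime p" by (auto simp: P_def)
      have "ln (real p) * w p / real p \<le> ln (real p) * w p / 1"
        using p w[of p] by (intro divide_left_mono) auto
      also have "\<dots> \<le> B * ln (real p)"
        using p w[of p] by (simp add: mult.commute mult_right_mono)
      finally show "mangoldt p * w p / real p \<le> B * ln (real p)" using p by simp
    qed
    also have "\<dots> \<le> (\<Sum>p\<in>Z. B * ln (real p))"
      using ramified by (intro sum_mono2) (auto simp: Z_def B_def dest: prime_gt_0_nat)
    also have "\<dots> = B * (\<Sum>p\<in>Z. ln (real p))" by (simp add: sum_distrib_left)
    finally show ?thesis by simp
  qed
  have "\<exists>K. \<forall>N. \<bar>\<Sum>d=1..N. mangoldt d * (\<Prod>i\<in>J. \<chi> i d) / real d\<bar> \<le> K" if "J \<in> Pow I - {{}}" for J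
    using char[of J] that real_character.sum_mangoldt_bounded by blast
  then obtain K where K: "\<And>J N. J \<in> Pow I - {{}} \<Longrightarrow>
      \<bar>\<Sum>d=1..N. mangoldt d * (\<Prod>i\<in>J. \<chi> i d) / real d\<bar> \<le> K J"
    by metis
  have lower: "ln (real N) - 1 - (\<Sum>J\<in>Pow I - {{}}. K J) \<le> (\<Sum>d=1..N. mangoldt d * w d / real d)"
    if "N > 0" for N
  proof -
    define S where "S J = (\<Sum>d=1..N. mangoldt d * (\<Prod>i\<in>J. \<chi> i d) / real d)" for J
    have sgn: "(\<Prod>i\<in>J. \<epsilon> i) \<in> {-1, 1}" if "J \<subseteq> I" for J
      using finite_subset[OF that I] that
    proof (induction J rule: finite_induct)
      case (insert i J)
      then show ?case using \<epsilon>[of i] by auto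
    qed simp
    have w_eq: "w d = (\<Sum>J\<in>Pow I. (\<Prod>i\<in>J. \<epsilon> i) * (\<Prod>i\<in>J. \<chi> i d))" for d
      unfolding w_def using prod_add[OF I, of "\<lambda>i. \<epsilon> i * \<chi> i d" "\<lambda>_. 1"]
      by (simp add: prod.distrib add.commute)
    have "(\<Sum>d=1..N. mangoldt d * w d / real d)
        = (\<Sum>d=1..N. \<Sum>J\<in>Pow I. (\<Prod>i\<in>J. \<epsilon> i) * (mangoldt d * (\<Prod>i\<in>J. \<chi> i d) / real d))"
      unfolding w_eq by (simp add: sum_distrib_left sum_divide_distrib mult_ac)
    also have "\<dots> = (\<Sum>J\<in>Pow I. (\<Prod>i\<in>J. \<epsilon> i) * S J)"
      unfolding S_def by (subst sum.swap) (simp add: sum_distrib_left)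
    also have "\<dots> = S {} + (\<Sum>J\<in>Pow I - {{}}. (\<Prod>i\<in>J. \<epsilon> i) * S J)"
      using I by (subst sum.remove[of _ "{}"]) auto
    also have "\<dots> \<ge> (ln (real N) - 1) + (\<Sum>J\<in>Pow I - {{}}. - K J)"
    proof (intro add_mono sum_mono)
      show "ln (real N) - 1 \<le> S {}" using mertens_lower[OF that] by (simp add: S_def)
      fix J assume J: "J \<in> Pow I - {{}}"
      then show "- K J \<le> (\<Prod>i\<in>J. \<epsilon> i) * S J"
        using sgn[of J] K[OF J, of N] unfolding S_def by auto
    qed
    finally show ?thesis by (simp add: sum_negf)
  qed
  define R where "R = B * 8 + B * (\<Sum>p\<in>Z. ln (real p)) + 1 + (\<Sum>J\<in>Pow I - {{}}. K J)"
  obtain N :: nat where N: "exp (R + 1) < real N" using reals_Archimedean2 by blast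
  then have "N > 0" using exp_gt_zero[of "R + 1"] by (cases N) (auto simp: not_less)
  then have "R + 1 < ln (real N)" using N by (metis exp_gt_zero ln_exp ln_less_cancel_iff of_nat_0_less_iff)
  moreover have "ln (real N) \<le> R" using lower[OF \<open>N > 0\<close>] upper[of N] unfolding R_def by linarith
  ultimately show False by simp
qed

section \<open>Legendre symbols as characters\<close>

text \<open>Multiplication by \<open>a\<close> permutes the residues modulo \<open>M\<close> and
  reverses the sign of \<open>f\<close>, so the sum over a period vanishes. In the bound
  \<open>M + 1\<close> the extra 1 pays for \<open>f 0\<close>, since the locale sums from
  1.\<close>

lemma real_character_of_periodic:
  assumes one: "f 1 = (1 :: real)" and mult: "\<And>a b. f (a * b) = f a * f b"
    and vals: "\<And>n. f n \<in> {-1, 0, 1}"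
    and period: "M > 0" "\<And>n. f (n + M) = f n"
    and nontrivial: "coprime a M" "f a = -1"
  shows "\<exists>C. real_character f C"
proof -
  have f_mod: "f (n mod M) = f n" for n
  proof -
    have "f (r + M * k) = f r" for r k
    proof (induction k)
      case (Suc k)
      have "r + M * Suc k = (r + M * k) + M" by simp
      then show ?case using Suc period(2) by metis
    qed simp
    from this[of "n mod M" "n div M"] show ?thesis by simp
  qed
  define T where "T N = (\<Sum>n<N. f n)" for N
  have inj: "inj_on (\<lambda>n. a * n mod M) {..<M}"
  proof (rule inj_onI)
    fix x y assume "x \<in> {..<M}" "y \<in> {..<M}" "a * x mod M = a * y mod M"
    then show "x = y"
      using nontrivial(1) by (metis cong_def cong_mult_lcancel_nat lessThan_iff mod_less)
  qed
  then have img: "(\<lambda>n. a * n mod M) ` {..<M} = {..<M}"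
    using period(1) by (intro endo_inj_surj) auto
  have "T M = (\<Sum>n\<in>(\<lambda>n. a * n mod M) ` {..<M}. f n)" by (simp add: img T_def)
  also have "\<dots> = (\<Sum>n<M. f a * f n)"
    by (subst sum.reindex[OF inj]) (simp add: f_mod mult)
  also have "\<dots> = - T M" by (simp add: nontrivial(2) T_def sum_negf)
  finally have T_period: "T M = 0" by simp
  have T_add: "T (N + M) = T N" for N
    by (induction N) (use T_period in \<open>simp_all add: T_def period(2)\<close>)
  have f_le: "\<bar>f n\<bar> \<le> 1" for n using vals[of n] by auto
  have T_le: "\<bar>T N\<bar> \<le> real M" for N
  proof (induction N rule: less_induct)
    case (less N)
    show ?case
    proof (cases "N < M")
      case True
      have "\<bar>T N\<bar> \<le> (\<Sum>n<N. 1)"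
        unfolding T_def by (rule order.trans[OF sum_abs sum_mono]) (rule f_le)
      then show ?thesis using True by simp
    next
      case False
      then show ?thesis using less.IH[of "N - M"] T_add[of "N - M"] period(1) by simp
    qed
  qed
  have "\<bar>\<Sum>n=1..N. f n\<bar> \<le> real M + 1" for N
  proof -
    have "{..<Suc N} = insert 0 {1..N}" by auto
    then have "T (Suc N) = f 0 + (\<Sum>n=1..N. f n)" by (simp add: T_def)
    then show ?thesis using T_le[of "Suc N"] f_le[of 0] by linarith
  qed
  then have "real_character f (real M + 1)"
    using one mult vals by unfold_locales auto
  then show ?thesis by blast
qed

text \<open>The Kronecker symbol (-4/n), which at odd primes is the quadratic character of
  -1.\<close>

definition chi4 :: "nat \<Rightarrow> int" where
  "chi4 n = (if n mod 4 = 1 then 1 else if n mod 4 = 3 then -1 else 0)"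

text \<open>The Kronecker symbol (8/n), which at odd primes is the quadratic character of 2.\<close>

definition chi8 :: "nat \<Rightarrow> int" where
  "chi8 n = (if n mod 8 = 1 \<or> n mod 8 = 7 then 1 else if n mod 8 = 3 \<or> n mod 8 = 5 then -1 else 0)"

lemma chi4_mult: "chi4 (a * b) = chi4 a * chi4 b"
proof -
  have "a mod 4 = 0 \<or> a mod 4 = 1 \<or> a mod 4 = 2 \<or> a mod 4 = 3" for a :: nat by presburger
  from this[of a] this[of b] show ?thesis
    unfolding chi4_def mod_mult_eq[of a 4 b, symmetric] by (elim disjE) simp_all
qed

lemma chi8_mult: "chi8 (a * b) = chi8 a * chi8 b"
proof -
  have "a mod 8 = 0 \<or> a mod 8 = 1 \<or> a mod 8 = 2 \<or> a mod 8 = 3 \<or>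
        a mod 8 = 4 \<or> a mod 8 = 5 \<or> a mod 8 = 6 \<or> a mod 8 = 7" for a :: nat by presburger
  from this[of a] this[of b] show ?thesis
    unfolding chi8_def mod_mult_eq[of a 8 b, symmetric] by (elim disjE) simp_all
qed

section \<open>Values of Legendre symbols\<close>

lemma Legendre_values: "Legendre a p \<in> {-1, 0, 1}"
  by (simp add: Legendre_def)

lemma Legendre_cong: "[a = b] (mod p) \<Longrightarrow> Legendre a p = Legendre b p"
  by (simp add: Legendre_def QuadRes_def cong_def)

text \<open>Turns the congruences of Euler's criterion into equalities.\<close>

lemma cong_imp_eq_of_small:
  fixes a b p :: int
  assumes "[a = b] (mod p)" "p > 2" "a \<in> {-1, 0, 1}" "b \<in> {-1, 0, 1}"
  shows "a = b"
proof -
  have "p dvd a - b" using assms(1) by (simp add: cong_iff_dvd_diff)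
  moreover have "\<bar>a - b\<bar> < p" using assms by auto
  ultimately show ?thesis using zdvd_not_zless[of "\<bar>a - b\<bar>" p] by auto
qed

lemma Legendre_mult:
  assumes "prime p" "p > 2"
  shows "Legendre (a * b) (int p) = Legendre a (int p) * Legendre b (int p)"
proof (rule cong_imp_eq_of_small)
  have "[Legendre (a * b) p = (a * b) ^ ((p - 1) div 2)] (mod p)"
    by (rule euler_criterion[OF assms])
  also have "(a * b) ^ ((p - 1) div 2) = a ^ ((p - 1) div 2) * b ^ ((p - 1) div 2)"
    by (rule power_mult_distrib)
  also have "[\<dots> = Legendre a p * Legendre b p] (mod p)"
    by (intro cong_mult cong_sym[OF euler_criterion[OF assms]])
  finally show "[Legendre (a * b) p = Legendre a p * Legendre b p] (mod p)" .
  show "Legendre a p * Legendre b p \<in> {-1, 0, 1}"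
    using Legendre_values[of a p] Legendre_values[of b p] by auto
qed (use assms Legendre_values in auto)

lemma Legendre_one:
  assumes "p > (1 :: int)"
  shows "Legendre 1 p = 1"
proof -
  have "[1\<^sup>2 = 1] (mod p)" by simp
  then have "QuadRes p 1" unfolding QuadRes_def by blast
  moreover have "\<not> [1 = 0] (mod p)" using assms by (simp add: cong_def)
  ultimately show ?thesis by (simp add: Legendre_def)
qed

lemma Legendre_prod:
  assumes "prime p" "p > 2" "finite Q"
  shows "Legendre (\<Prod>q\<in>Q. g q) (int p) = (\<Prod>q\<in>Q. Legendre (g q) (int p))"
  using assms(3)
proof (induction Q rule: finite_induct)
  case empty
  then show ?case using assms by (simp add: Legendre_one)
next
  case (insert q Q)
  then show ?case using assms by (simp add: Legendre_mult)
qed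

lemma Legendre_minus_one:
  assumes "prime p" "p > 2"
  shows "Legendre (-1) (int p) = chi4 p"
proof (rule cong_imp_eq_of_small)
  have "odd p" using assms prime_odd_nat by blast
  then have "p mod 4 = 1 \<or> p mod 4 = 3" by presburger
  then have "(-1) ^ ((p - 1) div 2) = chi4 p"
  proof
    assume "p mod 4 = 1"
    then have "even ((p - 1) div 2)" by presburger
    then show ?thesis using \<open>p mod 4 = 1\<close> by (simp add: chi4_def)
  next
    assume "p mod 4 = 3"
    then have "odd ((p - 1) div 2)" by presburger
    then show ?thesis using \<open>p mod 4 = 3\<close> by (simp add: chi4_def)
  qed
  then show "[Legendre (-1) p = chi4 p] (mod p)"
    using euler_criterion[OF assms, of "-1"] by simp
  show "chi4 p \<in> {-1, 0, 1}" by (simp add: chi4_def)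
qed (use assms Legendre_values in auto)

text \<open>Squaring modulo \<open>q\<close> is not injective on \<open>{1..<q}\<close>, as 1 and
  \<open>q - 1\<close> have the same square, hence it is not surjective.\<close>

lemma exists_nonresidue:
  assumes "prime q" "q > 2"
  shows "\<exists>g::nat. Legendre (int g) (int q) = -1"
proof -
  define f where "f y = y\<^sup>2 mod q" for y
  have maps: "f ` {1..<q} \<subseteq> {1..<q}"
  proof
    fix z assume "z \<in> f ` {1..<q}"
    then obtain y where y: "y \<in> {1..<q}" "z = y\<^sup>2 mod q" by (auto simp: f_def)
    then have "\<not> q dvd y" by (auto dest: dvd_imp_le)
    then have "\<not> q dvd y\<^sup>2" using assms prime_dvd_power by blast
    then have "z \<noteq> 0" using y by (simp add: dvd_eq_mod_eq_0)
    moreover have "z < q" using y assms by simp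
    ultimately show "z \<in> {1..<q}" by simp
  qed
  have "f (q - 1) = f 1"
  proof -
    have "(q - 1)\<^sup>2 = 1 + q * (q - 2)"
    proof -
      obtain k where "q = k + 2" using assms by (metis add.commute le_Suc_ex less_imp_le)
      then show ?thesis by (simp add: power2_eq_square)
    qed
    then have "f (q - 1) = 1 mod q" unfolding f_def by (simp only: mod_mult_self2)
    then show ?thesis by (simp add: f_def)
  qed
  then have "\<not> inj_on f {1..<q}" using assms by (auto dest!: inj_onD[of f _ "q - 1" 1])
  then have "f ` {1..<q} \<noteq> {1..<q}" using finite_surj_inj[of "{1..<q}" f] by auto
  then obtain g where g: "g \<in> {1..<q}" "g \<notin> f ` {1..<q}" using maps by blast
  have "\<not> QuadRes q g"
  proof
    assume "QuadRes q g"
    then obtain y where y: "[y\<^sup>2 = int g] (mod int q)" by (auto simp: QuadRes_def)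
    define r where "r = nat (y mod int q)"
    have r: "int r = y mod int q" "r < q" using assms by (simp_all add: r_def nat_less_iff)
    have "[(int r)\<^sup>2 = int g] (mod int q)"
      using y unfolding r cong_def by (simp add: power_mod)
    then have "[r\<^sup>2 = g] (mod q)" by (metis cong_int_iff of_nat_power)
    then have "f r = g" using g by (simp add: cong_def f_def)
    moreover have "r \<noteq> 0" using \<open>f r = g\<close> g by (auto simp: f_def intro: Nat.gr0I)
    ultimately show False using g r by auto
  qed
  moreover have "\<not> [int g = 0] (mod int q)" using g by (simp add: cong_def)
  ultimately have "Legendre (int g) (int q) = -1" by (simp add: Legendre_def)
  then show ?thesis by blast
qed

text \<open>The non-primes 4 and 8 serve as indices of the two characters modulo 4 and 8.\<close>

definition basic_character :: "nat \<Rightarrow> nat \<Rightarrow> int" where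
  "basic_character i n =
     (if i = 4 then chi4 n else if i = 8 then chi8 n else Legendre (int n) (int i))"

lemma not_prime_4_8 [simp]: "\<not> prime (4 :: nat)" "\<not> prime (8 :: nat)"
  using primes_dvd_imp_eq[of 2 "4 :: nat"] primes_dvd_imp_eq[of 2 "8 :: nat"] two_is_prime_nat by auto

section \<open>Independence of the basic characters and the auxiliary prime\<close>

context
  fixes Q :: "nat set"
  assumes finite_Q: "finite Q" and Q: "\<And>q. q \<in> Q \<Longrightarrow> prime q \<and> q > 2"
begin

private lemma basic_Q: "q \<in> Q \<Longrightarrow> basic_character q n = Legendre (int n) (int q)"
  using Q not_prime_4_8 unfolding basic_character_def by metis

private lemma basic_values: "basic_character i n \<in> {-1, 0, 1}"
  using Legendre_values by (simp add: basic_character_def chi4_def chi8_def)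

private lemma basic_mult:
  "i \<in> insert 4 (insert 8 Q) \<Longrightarrow> basic_character i (a * b) = basic_character i a * basic_character i b"
  using Q by (auto simp: basic_character_def chi4_mult chi8_mult Legendre_mult)

private lemma basic_one: "i \<in> insert 4 (insert 8 Q) \<Longrightarrow> basic_character i 1 = 1"
  using Q by (fastforce simp: basic_character_def chi4_def chi8_def Legendre_one)

private lemma basic_cong:
  assumes "i \<in> insert 4 (insert 8 Q)" "[a = b] (mod i)"
  shows "basic_character i a = basic_character i b"
proof -
  have "Legendre (int a) (int i) = Legendre (int b) (int i)"
    using assms(2) by (intro Legendre_cong) (simp add: cong_int_iff)
  moreover have "chi4 a = chi4 b" if "i = 4" using assms(2) that by (simp add: chi4_def cong_def)
  moreover have "chi8 a = chi8 b" if "i = 8" using assms(2) that by (simp add: chi8_def cong_def)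
  ultimately show ?thesis by (simp add: basic_character_def)
qed

text \<open>The point is a unit modulo the common period \<open>M\<close> at which the product is
  -1. If \<open>J\<close> contains some \<open>q\<close> in \<open>Q\<close>, take a nonresidue
  modulo \<open>q\<close> that is 1 modulo the cofactor; otherwise prescribe a class modulo
  8.\<close>

lemma real_character_prod_basic:
  assumes J: "J \<subseteq> insert 4 (insert 8 Q)" "J \<noteq> {}"
  shows "\<exists>C. real_character (\<lambda>n. \<Prod>i\<in>J. real_of_int (basic_character i n)) C"
proof -
  define M where "M = 8 * \<Prod>Q"
  have finJ: "finite J" using finite_subset[OF J(1)] finite_Q by simp
  have "\<Prod>Q > 0" using Q prime_gt_0_nat by (intro prod_pos) blast
  then have M: "M > 0" by (simp add: M_def)
  have dvd_M: "i dvd M" if "i \<in> insert 4 (insert 8 Q)" for i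
    using that finite_Q unfolding M_def by (auto intro: dvd_mult dvd_prodI)
  have "\<exists>a. coprime a M \<and> (\<Prod>i\<in>J. basic_character i a) = -1"
  proof (cases "J \<inter> Q = {}")
    case True
    \<comment> \<open>At 3 both \<open>chi4\<close> and \<open>chi8\<close> are -1, so that their
      product is 1; at 5 only \<open>chi8\<close> is -1.\<close>
    define a :: nat where "a = (if 8 \<in> J \<and> 4 \<in> J then 5 else 3)"
    have "coprime (\<Prod>Q) 8"
    proof (rule prod_coprime_left)
      fix q assume "q \<in> Q"
      then have "odd q" using Q prime_odd_nat by blast
      then have "coprime q (2 ^ 3)" by (intro coprime_power_right_iff[THEN iffD2]) simp
      then show "coprime q 8" by simp
    qed
    then obtain b where b: "[b = a] (mod 8)" "[b = 1] (mod \<Prod>Q)"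
      using binary_chinese_remainder_nat[of 8 "\<Prod>Q" a 1] by (auto simp: coprime_commute)
    have "b mod 8 = 3 \<or> b mod 8 = 5" using b(1) unfolding cong_def by (simp add: a_def)
    then have "odd b" by presburger
    then have "coprime b (2 ^ 3)" by (intro coprime_power_right_iff[THEN iffD2]) simp
    moreover have "coprime b (\<Prod>Q)" using cong_imp_coprime[OF cong_sym[OF b(2)]] by simp
    ultimately have "coprime b M" by (simp add: M_def)
    moreover have "(\<Prod>i\<in>J. basic_character i b) = -1"
    proof -
      have mods: "b mod 8 = a" using b(1) unfolding cong_def by (simp add: a_def)
      have "b mod 4 = b mod 8 mod 4" by (simp add: mod_mod_cancel)
      then have mods4: "b mod 4 = a mod 4" by (simp only: mods)
      have "J \<in> Pow {4, 8}" using True J(1) by blast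
      then consider "J = {4, 8}" | "J = {4}" | "J = {8}" using J(2) unfolding Pow_insert by auto
      then show ?thesis
      proof cases
        case 1
        then have "a = 5" by (simp add: a_def)
        then show ?thesis using mods mods4 1 by (simp add: basic_character_def chi4_def chi8_def)
      next
        case 2
        then have "a = 3" by (simp add: a_def)
        then show ?thesis using mods mods4 2 by (simp add: basic_character_def chi4_def chi8_def)
      next
        case 3
        then have "a = 3" by (simp add: a_def)
        then show ?thesis using mods mods4 3 by (simp add: basic_character_def chi4_def chi8_def)
      qed
    qed
    ultimately show ?thesis by blast
  next
    case False
    then obtain q where q: "q \<in> J" "q \<in> Q" by blast
    then have pq: "prime q" "q > 2" using Q by auto
    define R where "R = 8 * \<Prod>(Q - {q})"
    have MR: "M = q * R" unfolding M_def R_def using finite_Q q by (subst prod.remove[of Q q]) auto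
    obtain g :: nat where g: "Legendre (int g) (int q) = -1" using exists_nonresidue[OF pq] by blast
    have "coprime q R"
      unfolding R_def coprime_mult_right_iff
    proof
      have "odd q" using pq prime_odd_nat by blast
      then have "coprime q (2 ^ 3)" by (intro coprime_power_right_iff[THEN iffD2]) simp
      then show "coprime q 8" by simp
      show "coprime q (\<Prod>(Q - {q}))"
        using pq Q by (intro prod_coprime_right) (auto intro: primes_coprime)
    qed
    then obtain a where a: "[a = g] (mod q)" "[a = 1] (mod R)"
      using binary_chinese_remainder_nat by blast
    have La: "basic_character q a = -1"
      using g a(1) basic_Q[OF q(2)] Legendre_cong[of "int a" "int g" "int q"] by (simp add: cong_int_iff)
    have "\<not> q dvd a"
    proof
      assume "q dvd a"
      then have "[int a = 0] (mod int q)" by (simp add: cong_0_iff)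
      then show False using La basic_Q[OF q(2)] by (simp add: Legendre_def)
    qed
    then have "coprime a q" using pq by (metis coprime_commute prime_imp_coprime)
    moreover have "coprime a R" using cong_imp_coprime[OF cong_sym[OF a(2)]] by simp
    ultimately have "coprime a M" by (simp add: MR)
    moreover have "basic_character i a = 1" if "i \<in> J - {q}" for i
    proof -
      have i: "i \<in> insert 4 (insert 8 Q)" using that J by auto
      have "i = 4 \<or> i = 8 \<or> i \<in> Q - {q}" using that i by blast
      then have "i dvd R"
      proof (elim disjE)
        assume "i \<in> Q - {q}"
        then have "i dvd \<Prod>(Q - {q})" using finite_Q by (intro dvd_prodI) auto
        then show ?thesis unfolding R_def by (rule dvd_mult)
      qed (simp_all add: R_def)
      then have "[a = 1] (mod i)" using a(2) cong_dvd_modulus_nat by blast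
      then show ?thesis using basic_cong[OF i] basic_one[OF i] by simp
    qed
    then have "(\<Prod>i\<in>J. basic_character i a) = -1"
      using La q finJ by (subst prod.remove[of J q]) auto
    ultimately show ?thesis by blast
  qed
  then obtain a where a: "coprime a M" "(\<Prod>i\<in>J. basic_character i a) = -1" by blast
  show ?thesis
  proof (rule real_character_of_periodic[where M = M and a = a])
    show "(\<Prod>i\<in>J. real_of_int (basic_character i 1)) = 1"
      using J basic_one by (intro prod.neutral) auto
    show "(\<Prod>i\<in>J. real_of_int (basic_character i (a * b)))
      = (\<Prod>i\<in>J. real_of_int (basic_character i a)) * (\<Prod>i\<in>J. real_of_int (basic_character i b))" for a b
      unfolding prod.distrib[symmetric] using J basic_mult by (intro prod.cong) auto
    show "(\<Prod>i\<in>J. real_of_int (basic_character i n)) \<in> {-1, 0, 1}" for n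
      using finJ
    proof (induction J rule: finite_induct)
      case (insert i J)
      then show ?case using basic_values[of i n] by auto
    qed simp
    show "(\<Prod>i\<in>J. real_of_int (basic_character i (n + M))) = (\<Prod>i\<in>J. real_of_int (basic_character i n))" for n
    proof (intro prod.cong refl)
      fix i assume "i \<in> J"
      then have i: "i \<in> insert 4 (insert 8 Q)" using J by blast
      have "[n + M = n] (mod i)" using dvd_M[OF i] by (simp add: cong_def mod_add_eq[of n i M, symmetric] dvd_imp_mod_0)
      then show "real_of_int (basic_character i (n + M)) = real_of_int (basic_character i n)"
        using basic_cong[OF i] by simp
    qed
    show "(\<Prod>i\<in>J. real_of_int (basic_character i a)) = -1"
      using a(2) by (metis of_int_1 of_int_minus of_int_prod)
  qed (use M a in auto)
qed

text \<open>As \<open>chi4 q\<close> is the symbol of -1 modulo \<open>q\<close>, the last condition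
  makes \<open>- p\<close> a square modulo every \<open>q\<close> in \<open>Q\<close>. The sign
  \<open>s\<close> decides between 1 and 5 modulo 8.\<close>

lemma exists_auxiliary_prime:
  assumes s: "s \<in> {-1, 1}"
  shows "\<exists>p. prime p \<and> p mod 4 = 1 \<and> chi8 p = s \<and> (\<forall>q\<in>Q. Legendre (int p) (int q) = chi4 q)"
proof -
  define I where "I = insert 4 (insert 8 Q)"
  define \<epsilon> where "\<epsilon> i = real_of_int (if i = 4 then 1 else if i = 8 then s else chi4 i)" for i
  have "\<exists>p. prime p \<and> (\<forall>i\<in>I. real_of_int (basic_character i p) = \<epsilon> i)"
  proof (rule prime_with_character_values)
    show "finite I" using finite_Q by (simp add: I_def)
    show "\<exists>C. real_character (\<lambda>n. \<Prod>i\<in>J. real_of_int (basic_character i n)) C" if "J \<subseteq> I" "J \<noteq> {}" for J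
      using real_character_prod_basic that unfolding I_def .
    show "\<epsilon> i \<in> {-1, 1}" if "i \<in> I" for i
    proof -
      have chi4_Q: "chi4 q = -1 \<or> chi4 q = 1" if "q \<in> Q" for q
      proof -
        have "odd q" using Q that prime_odd_nat by blast
        then have "q mod 4 = 1 \<or> q mod 4 = 3" by presburger
        then show ?thesis by (auto simp: chi4_def)
      qed
      then show ?thesis using that s by (auto simp: I_def \<epsilon>_def dest!: chi4_Q)
    qed
    have "{p. prime p \<and> (\<exists>i\<in>I. real_of_int (basic_character i p) = 0)} \<subseteq> insert 2 Q"
    proof
      fix p assume "p \<in> {p. prime p \<and> (\<exists>i\<in>I. real_of_int (basic_character i p) = 0)}"
      then obtain i where i: "prime p" "i \<in> I" "basic_character i p = 0" by auto
      show "p \<in> insert 2 Q"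
      proof (cases "i \<in> Q")
        case True
        then have "Legendre (int p) (int i) = 0" using i basic_Q by simp
        then have "[int p = 0] (mod int i)" by (simp add: Legendre_def split: if_splits)
        then have "i dvd p" by (simp add: cong_0_iff)
        then have "i = p" using i Q[OF True] primes_dvd_imp_eq by blast
        then show ?thesis using True by simp
      next
        case False
        have "even p"
        proof (rule ccontr)
          assume "odd p"
          then have "p mod 4 = 1 \<or> p mod 4 = 3" "p mod 8 = 1 \<or> p mod 8 = 3 \<or> p mod 8 = 5 \<or> p mod 8 = 7"
            by presburger+
          then show False using i False by (auto simp: I_def basic_character_def chi4_def chi8_def)
        qed
        then show ?thesis using i primes_dvd_imp_eq[of 2 p] by simp
      qed
    qed
    then show "finite {p. prime p \<and> (\<exists>i\<in>I. real_of_int (basic_character i p) = 0)}"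
      using finite_Q finite_subset by blast
  qed
  then obtain p where p: "prime p" "\<And>i. i \<in> I \<Longrightarrow> real_of_int (basic_character i p) = \<epsilon> i" by blast
  have "chi4 p = 1" "chi8 p = s"
    using p(2)[of 4] p(2)[of 8] by (simp_all add: I_def \<epsilon>_def basic_character_def)
  then have "p mod 4 = 1" by (simp add: chi4_def split: if_splits)
  moreover have "Legendre (int p) (int q) = chi4 q" if "q \<in> Q" for q
  proof -
    have "q \<noteq> 4" "q \<noteq> 8" using Q[OF that] not_prime_4_8 by auto
    then show ?thesis using p(2)[of q] that basic_Q[OF that] by (simp add: I_def \<epsilon>_def)
  qed
  ultimately show ?thesis using p(1) \<open>chi8 p = s\<close> by blast
qed

end

section \<open>Sums of three squares and of four hexagonal numbers\<close>

text \<open>Gauss's lemma for \<open>p = 4 k + 1\<close>: among the numbers \<open>2 x\<close> with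
  \<open>0 < x \<le> 2 k\<close>, those above \<open>(p - 1) / 2\<close> have \<open>x > k\<close>.
  There are \<open>k\<close> of them, and the parity of \<open>k\<close> determines \<open>p\<close>
  modulo 8.\<close>

lemma Legendre_two:
  assumes p: "prime p" "p mod 4 = 1"
  shows "Legendre 2 (int p) = chi8 p"
proof -
  have "p > 2" using p prime_gt_1_nat[OF p(1)] by (cases "p = 2") auto
  obtain k where k: "p = 4 * k + 1" using p(2) by (metis mult_div_mod_eq)
  interpret GAUSS p 2
    using p(1) \<open>p > 2\<close> by unfold_locales (auto simp: cong_0_iff zdvd_not_zless)
  have half: "(int p - 1) div 2 = 2 * int k" using k by simp
  have "C = (\<lambda>x. 2 * x) ` {0<..2 * int k}"
    unfolding C_def B_def A_def half image_image
    using k by (intro image_cong refl) (auto simp: mult.commute)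
  then have "E = (\<lambda>x. 2 * x) ` {int k<..2 * int k}"
    unfolding E_def half by auto
  then have "card E = k"
    by (simp add: card_image inj_on_def)
  then have L: "Legendre 2 (int p) = (-1) ^ k" using gauss_lemma by simp
  show ?thesis
  proof (cases "even k")
    case True
    then have "p mod 8 = 1" using k by presburger
    then show ?thesis using L True by (simp add: chi8_def)
  next
    case False
    then have "p mod 8 = 5" using k by presburger
    then show ?thesis using L False by (simp add: chi8_def)
  qed
qed

text \<open>The exponent of the sign in the reciprocity law is even because
  \<open>(p - 1) div 2\<close> is.\<close>

lemma Legendre_reciprocity_mod_4:
  assumes "prime p" "p mod 4 = 1" "prime q" "q > 2" "p \<noteq> q"
  shows "Legendre (int q) (int p) = Legendre (int p) (int q)"
proof -
  have "p > 2" using assms prime_gt_1_nat[OF assms(1)] by (cases "p = 2") auto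
  have "even ((p - 1) div 2)" using assms(2) by presburger
  then have "Legendre (int p) (int q) * Legendre (int q) (int p) = 1"
    using Quadratic_Reciprocity[OF assms(1) \<open>p > 2\<close> assms(3,4,5)] by simp
  then show ?thesis
    using Legendre_values[of p q] Legendre_values[of q p] by auto
qed

text \<open>Chinese remaindering glues the roots modulo the single primes.\<close>

lemma square_root_mod_prod_primes:
  assumes "finite P" "\<And>q. q \<in> P \<Longrightarrow> prime q"
    and "\<And>q. q \<in> P \<Longrightarrow> \<exists>y. int q dvd y\<^sup>2 + c"
  shows "\<exists>y. int (\<Prod>P) dvd y\<^sup>2 + c"
  using assms
proof (induction P rule: finite_induct)
  case (insert q P)
  obtain y where y: "int (\<Prod>P) dvd y\<^sup>2 + c" using insert.IH insert.prems by auto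
  obtain z where z: "int q dvd z\<^sup>2 + c" using insert.prems(2)[of q] by auto
  have cop: "coprime (int q) (int (\<Prod>P))"
    using insert by (subst coprime_int_iff, intro prod_coprime_right) (auto intro: primes_coprime)
  then obtain x where x: "[x = z] (mod int q)" "[x = y] (mod int (\<Prod>P))"
    using binary_chinese_remainder_int by blast
  have "[x\<^sup>2 + c = z\<^sup>2 + c] (mod int q)" "[x\<^sup>2 + c = y\<^sup>2 + c] (mod int (\<Prod>P))"
    by (rule cong_add[OF cong_pow[OF x(1)] cong_refl], rule cong_add[OF cong_pow[OF x(2)] cong_refl])
  then have "int q dvd x\<^sup>2 + c" "int (\<Prod>P) dvd x\<^sup>2 + c"
    using y z cong_dvd_iff by blast+
  then have "int q * int (\<Prod>P) dvd x\<^sup>2 + c" using cop by (simp add: divides_mult)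
  then show ?case using insert by auto
qed simp

lemma prime_not_square: "prime p \<Longrightarrow> int p \<noteq> k\<^sup>2"
proof
  assume p: "prime p" "int p = k\<^sup>2"
  then have "p = (nat \<bar>k\<bar>)\<^sup>2" by (metis nat_int nat_power_eq abs_ge_zero power2_abs)
  then show False using p(1) by (auto simp: prime_power_iff)
qed

text \<open>Up to rational squares, one isotropic form expresses \<open>m\<close> as
  \<open>z^2 + p r^2\<close> and a second one expresses \<open>p\<close> as a sum of two squares.
  Substituting gives three rational squares.\<close>

lemma three_squares_squarefree:
  fixes m :: nat
  assumes sf: "squarefree m" and mod4: "m mod 4 = 1 \<or> m mod 4 = 2"
  shows "\<exists>x y z :: int. int m = x\<^sup>2 + y\<^sup>2 + z\<^sup>2"
proof -
  have m0: "m \<noteq> 0" using mod4 by auto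
  define Q where "Q = prime_factors m - {2}"
  define m' where "m' = \<Prod>Q"
  have finite_Q: "finite Q" by (simp add: Q_def)
  have Q: "prime q \<and> q > 2" if "q \<in> Q" for q
  proof -
    have "prime q" "q \<noteq> 2" using that by (auto simp: Q_def)
    then show ?thesis using prime_ge_2_nat[of q] by simp
  qed
  have m_prod: "m = \<Prod>(prime_factors m)"
  proof -
    have "m = (\<Prod>p\<in>prime_factors m. p ^ multiplicity p m)"
      using prod_prime_factors[OF m0] by simp
    also have "\<dots> = \<Prod>(prime_factors m)"
      using sf m0 by (intro prod.cong refl) (simp add: squarefree_factorial_semiring'[OF m0])
    finally show ?thesis .
  qed
  have m_eq: "m = (if even m then 2 else 1) * m'"
  proof (cases "even m")
    case True
    then have "2 \<in> prime_factors m" using m0 by (simp add: prime_factors_dvd)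
    then have "\<Prod>(prime_factors m) = 2 * m'"
      unfolding m'_def Q_def by (intro prod.remove) auto
    then show ?thesis using m_prod True by simp
  next
    case False
    then have "2 \<notin> prime_factors m" using in_prime_factors_imp_dvd by blast
    then have "Q = prime_factors m" by (auto simp: Q_def)
    then have "\<Prod>(prime_factors m) = m'" by (simp only: m'_def)
    then show ?thesis using m_prod False by simp
  qed
  have odd_m': "odd m'"
    unfolding m'_def using Q finite_Q prime_odd_nat by (auto simp: even_prod_iff)
  \<comment> \<open>The symbol of \<open>m'\<close> modulo \<open>p\<close> will be
    \<open>s\<close>. For even \<open>m\<close> the choice \<open>chi8 p = s\<close> makes the
    symbol of \<open>2 m'\<close> equal to 1; for odd \<open>m\<close> the residue 1 modulo 4
    already forces \<open>s = 1\<close>.\<close>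
  define s where "s = chi4 m'"
  have "m' mod 4 = 1 \<or> m' mod 4 = 3" using odd_m' by presburger
  then have s: "s \<in> {-1, 1}" by (auto simp: s_def chi4_def)
  obtain p where p: "prime p" "p mod 4 = 1" "chi8 p = s"
    and pQ: "\<And>q. q \<in> Q \<Longrightarrow> Legendre (int p) (int q) = chi4 q"
    using exists_auxiliary_prime[OF finite_Q Q s] by blast
  have p2: "p > 2" using p prime_gt_1_nat[OF p(1)] by (cases "p = 2") auto
  have odd_p: "odd p" using p(2) by presburger
  have chi4_Q: "chi4 q = -1 \<or> chi4 q = 1" if "q \<in> Q" for q
  proof -
    have "odd q" using Q[OF that] prime_odd_nat by blast
    then have "q mod 4 = 1 \<or> q mod 4 = 3" by presburger
    then show ?thesis by (auto simp: chi4_def)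
  qed
  have p_notin: "p \<notin> Q"
  proof
    assume "p \<in> Q"
    then show False using pQ[of p] chi4_Q[of p] by (auto simp: Legendre_def cong_0_iff)
  qed
  have "\<exists>\<alpha>. int (\<Prod>(prime_factors m)) dvd \<alpha>\<^sup>2 + int p"
  proof (rule square_root_mod_prod_primes)
    fix q assume q: "q \<in> prime_factors m"
    show "\<exists>y. int q dvd y\<^sup>2 + int p"
    proof (cases "q = 2")
      case True
      then show ?thesis using odd_p by (intro exI[of _ 1]) simp
    next
      case False
      then have qQ: "q \<in> Q" using q by (simp add: Q_def)
      \<comment> \<open>The symbols of -1 and of \<open>p\<close> modulo \<open>q\<close> are both
        \<open>chi4 q\<close>, so their product is 1.\<close>
      have "Legendre (-1 * int p) (int q) = 1"
        using Q[OF qQ] pQ[OF qQ] chi4_Q[OF qQ] by (subst Legendre_mult) (auto simp: Legendre_minus_one)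
      then have "QuadRes (int q) (- int p)" by (simp add: Legendre_def split: if_splits)
      then obtain y where "[y\<^sup>2 = - int p] (mod int q)" by (auto simp: QuadRes_def)
      then have "int q dvd y\<^sup>2 + int p" by (simp add: cong_iff_dvd_diff)
      then show ?thesis by blast
    qed
  qed auto
  then obtain \<alpha> where \<alpha>: "int m dvd \<alpha>\<^sup>2 + int p" using m_prod by auto
  have "Legendre (int m') (int p) = s"
  proof -
    have "Legendre (int m') (int p) = (\<Prod>q\<in>Q. Legendre (int q) (int p))"
      unfolding m'_def using Legendre_prod[OF p(1) p2 finite_Q, of int] by simp
    also have "\<dots> = (\<Prod>q\<in>Q. chi4 q)"
    proof (rule prod.cong[OF refl])
      fix q assume q: "q \<in> Q"
      then have "p \<noteq> q" using p_notin by auto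
      then show "Legendre (int q) (int p) = chi4 q"
        using Legendre_reciprocity_mod_4[OF p(1,2), of q] Q[OF q] pQ[OF q] by simp
    qed
    also have "\<dots> = s"
      unfolding s_def m'_def using finite_Q
      by (induction Q rule: finite_induct) (simp_all add: chi4_mult, simp add: chi4_def)
    finally show ?thesis .
  qed
  then have "Legendre (int m) (int p) = 1"
  proof (cases "even m")
    case True
    then have "int m = 2 * int m'" using m_eq by simp
    then have "Legendre (int m) (int p) = chi8 p * s"
      using Legendre_mult[OF p(1) p2, of 2 "int m'"] Legendre_two[OF p(1,2)]
        \<open>Legendre (int m') (int p) = s\<close> by simp
    then show ?thesis using s p(3) by auto
  next
    case False
    then have "m mod 4 = 1" using mod4 by presburger
    moreover have "m = m'" using m_eq False by simp
    ultimately show ?thesis using \<open>Legendre (int m') (int p) = s\<close> by (simp add: s_def chi4_def)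
  qed
  then have "QuadRes (int p) (int m)" and nz: "\<not> [int m = 0] (mod int p)"
    by (auto simp: Legendre_def split: if_splits)
  then obtain \<beta> where "[\<beta>\<^sup>2 = int m] (mod int p)" by (auto simp: QuadRes_def)
  then have \<beta>: "int p dvd \<beta>\<^sup>2 - int m" by (simp add: cong_iff_dvd_diff)
  have cop: "coprime (int m) (int p)"
    using nz p(1) prime_imp_coprime[of p m] by (simp add: cong_0_iff coprime_commute)
  have nonsq: "\<nexists>k. int p = k\<^sup>2" using prime_not_square[OF p(1)] by blast
  obtain t z r where tzr: "t \<noteq> 0" "int m * t\<^sup>2 = z\<^sup>2 + int p * r\<^sup>2"
    using legendre_form_isotropic[of "int m" "int p" \<alpha> \<beta>] m0 p2 cop nonsq \<alpha> \<beta> by auto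
  obtain \<gamma> where \<gamma>: "int p dvd \<gamma>\<^sup>2 + 1"
  proof -
    have "Legendre (-1) (int p) = 1" using Legendre_minus_one[OF p(1) p2] p(2) by (simp add: chi4_def)
    then have "QuadRes (int p) (-1)" by (simp add: Legendre_def split: if_splits)
    then show ?thesis using that by (auto simp: QuadRes_def cong_iff_dvd_diff)
  qed
  \<comment> \<open>The same form with second coefficient 1: the congruence modulo 1 is trivial, so
    0 serves as its root.\<close>
  obtain u v w where uvw: "u \<noteq> 0" "int p * u\<^sup>2 = v\<^sup>2 + w\<^sup>2"
    using legendre_form_isotropic[of "int p" 1 \<gamma> 0] p2 nonsq \<gamma> by auto
  have "int m * (t * u)\<^sup>2 = (int m * t\<^sup>2) * u\<^sup>2" by (simp add: power_mult_distrib)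
  also have "\<dots> = z\<^sup>2 * u\<^sup>2 + (int p * u\<^sup>2) * r\<^sup>2" by (simp add: tzr(2) algebra_simps)
  also have "\<dots> = (z * u)\<^sup>2 + (v * r)\<^sup>2 + (w * r)\<^sup>2"
    by (simp add: uvw(2) power_mult_distrib algebra_simps)
  finally have "int m * \<bar>t * u\<bar>\<^sup>2 = (z * u)\<^sup>2 + (v * r)\<^sup>2 + (w * r)\<^sup>2" by simp
  moreover have "\<bar>t * u\<bar> > 0" using tzr(1) uvw(1) by simp
  ultimately show ?thesis by (rule three_squares_of_scaled[rotated])
qed

text \<open>As 4 does not divide \<open>m\<close>, the factor \<open>b\<close> is odd and
  \<open>b^2\<close> is 1 modulo 4, so the squarefree part keeps the residue of
  \<open>m\<close>.\<close>

lemma three_squares: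
  fixes m :: nat
  assumes mod4: "m mod 4 = 1 \<or> m mod 4 = 2"
  shows "\<exists>x y z :: int. int m = x\<^sup>2 + y\<^sup>2 + z\<^sup>2"
proof -
  define a b :: nat where "a = squarefree_part m" and "b = square_part m"
  have m: "m = a * b\<^sup>2" unfolding a_def b_def by (rule squarefree_decompose)
  have "odd b"
  proof
    assume "even b"
    then have "4 dvd b\<^sup>2" by (auto simp: power2_eq_square elim!: evenE)
    then have "4 dvd m" using m by simp
    then show False using mod4 by auto
  qed
  then have "b mod 4 = 1 \<or> b mod 4 = 3" by presburger
  then have "b\<^sup>2 mod 4 = 1"
    unfolding power_mod[of b 4 2, symmetric] by auto
  then have "m mod 4 = a mod 4" unfolding m by (metis mod_mult_right_eq mult.right_neutral)
  then obtain x y z :: int where "int a = x\<^sup>2 + y\<^sup>2 + z\<^sup>2"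
    using three_squares_squarefree[of a] mod4 unfolding a_def by auto
  then have "int m = (x * int b)\<^sup>2 + (y * int b)\<^sup>2 + (z * int b)\<^sup>2"
    unfolding m by (simp add: power_mult_distrib algebra_simps)
  then show ?thesis by blast
qed

section \<open>Choice of the four squares\<close>

lemma mult_two_le_sum_squares: "2 * x * y \<le> x\<^sup>2 + y\<^sup>2" for x y :: int
  using zero_le_power2[of "x - y"] unfolding power2_diff by linarith

text \<open>Cauchy-Schwarz against (1, 1, 1).\<close>

lemma sum_abs_bound_of_three_squares:
  fixes x y z B :: int
  assumes "3 * (x\<^sup>2 + y\<^sup>2 + z\<^sup>2) < B\<^sup>2" "B \<ge> 0"
  shows "\<bar>x\<bar> + \<bar>y\<bar> + \<bar>z\<bar> < B"
proof -
  have "(\<bar>x\<bar> + \<bar>y\<bar> + \<bar>z\<bar>)\<^sup>2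
      = x\<^sup>2 + y\<^sup>2 + z\<^sup>2 + 2 * \<bar>x\<bar> * \<bar>y\<bar> + 2 * \<bar>y\<bar> * \<bar>z\<bar> + 2 * \<bar>x\<bar> * \<bar>z\<bar>"
    by (simp add: power2_eq_square algebra_simps)
  also have "\<dots> \<le> 3 * (x\<^sup>2 + y\<^sup>2 + z\<^sup>2)"
    using mult_two_le_sum_squares[of "\<bar>x\<bar>" "\<bar>y\<bar>"] mult_two_le_sum_squares[of "\<bar>y\<bar>" "\<bar>z\<bar>"]
      mult_two_le_sum_squares[of "\<bar>x\<bar>" "\<bar>z\<bar>"] unfolding power2_abs distrib_left by linarith
  also have "\<dots> < B\<^sup>2" by fact
  finally show ?thesis using assms(2) by (rule power_less_imp_less_base)
qed

text \<open>Equal parity is what makes \<open>2 n + 1 - S^2\<close> congruent to 1 or 2 modulo 4; it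
  is also why the next candidate is \<open>S + 2\<close>.\<close>

lemma exists_largest_square_same_parity:
  "\<exists>S::nat. S mod 2 = n mod 2 \<and> S\<^sup>2 \<le> 2 * n + 1 \<and> 2 * n + 1 < (S + 2)\<^sup>2"
proof -
  define P where "P S \<longleftrightarrow> S mod 2 = n mod 2 \<and> S\<^sup>2 \<le> 2 * n + 1" for S :: nat
  define S where "S = (GREATEST S. P S)"
  have ex: "P (n mod 2)" by (cases "even n") (auto simp: P_def odd_iff_mod_2_eq_one)
  have bnd: "S \<le> 2 * n + 1" if "P S" for S
    using that self_le_power[of S 2] unfolding P_def by (cases "S = 0") auto
  have "P S" unfolding S_def by (rule GreatestI_nat[where P = P, OF ex]) (rule bnd)
  moreover have "\<not> P (S + 2)"
    using Greatest_le_nat[of P "S + 2" "2 * n + 1"] bnd unfolding S_def by auto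
  ultimately show ?thesis unfolding P_def by (intro exI[of _ S]) auto
qed

lemma square_mod_4:
  fixes x :: int
  shows "even x \<Longrightarrow> x\<^sup>2 mod 4 = 0" and "odd x \<Longrightarrow> x\<^sup>2 mod 4 = 1"
proof -
  show "x\<^sup>2 mod 4 = 0" if "even x" using that by (auto elim!: evenE simp: power2_eq_square)
  show "x\<^sup>2 mod 4 = 1" if "odd x"
  proof -
    from that obtain k where "x = 2 * k + 1" by (rule oddE)
    then have "x\<^sup>2 = 1 + 4 * (k * k + k)" by (simp add: power2_eq_square algebra_simps)
    then show ?thesis by (simp only: mod_mult_self2) simp
  qed
qed

text \<open>Modulo 4 a sum of squares counts its odd terms. Exactly one term is odd if
  \<open>e\<close> holds, exactly one is even otherwise, and this exceptional term is moved to
  \<open>C\<close>.\<close>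

lemma exists_parity_ordered:
  fixes m :: int
  assumes "\<exists>x y z :: int. m = x\<^sup>2 + y\<^sup>2 + z\<^sup>2" and "m mod 4 = (if e then 1 else 2)"
  shows "\<exists>C v w :: int. m = C\<^sup>2 + v\<^sup>2 + w\<^sup>2 \<and> even C \<noteq> e \<and> even v = e \<and> even w = e"
proof -
  obtain x y z :: int where m: "m = x\<^sup>2 + y\<^sup>2 + z\<^sup>2" using assms(1) by blast
  define r :: "int \<Rightarrow> int" where "r a = (if even a then 0 else 1)" for a
  have r: "[a\<^sup>2 = r a] (mod 4)" for a using square_mod_4[of a] by (simp add: r_def cong_def)
  have "m mod 4 = (r x + r y + r z) mod 4"
    unfolding m cong_def[symmetric] by (intro cong_add r)
  then have "(even x \<noteq> e \<and> even y = e \<and> even z = e) \<or> (even y \<noteq> e \<and> even x = e \<and> even z = e)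
      \<or> (even z \<noteq> e \<and> even y = e \<and> even x = e)"
    using assms(2) by (cases e; cases "even x"; cases "even y"; cases "even z") (auto simp: r_def)
  moreover have "m = y\<^sup>2 + x\<^sup>2 + z\<^sup>2" "m = z\<^sup>2 + y\<^sup>2 + x\<^sup>2" using m by simp_all
  ultimately show ?thesis using m by blast
qed

lemma hexagonal_large:
  fixes n :: nat
  assumes "n > 31"
  shows "\<exists>a b c d :: nat.
           int n = int a * (2 * int a - 1) + int b * (2 * int b - 1)
                 + int c * (2 * int c + 1) + int d * (2 * int d + 1)"
proof -
  obtain S :: nat where S: "S mod 2 = n mod 2" "S\<^sup>2 \<le> 2 * n + 1" "2 * n + 1 < (S + 2)\<^sup>2"
    using exists_largest_square_same_parity by blast
  \<comment> \<open>From \<open>n > 31\<close> follows \<open>2 n + 1 \<ge> 65 > 8^2\<close>, so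
    \<open>S + 2 > 8\<close>.\<close>
  have "S > 6"
  proof (rule ccontr)
    assume "\<not> ?thesis"
    then have "(S + 2)\<^sup>2 \<le> 8\<^sup>2" by (intro power_mono) auto
    then show False using S(3) assms by simp
  qed
  define m where "m = 2 * n + 1 - S\<^sup>2"
  have m: "int m = 2 * int n + 1 - (int S)\<^sup>2" using S(2) by (simp add: m_def of_nat_diff)
  define e where "e = even n"
  have m_mod: "int m mod 4 = (if e then 1 else 2)"
  proof (cases "even n")
    case True
    then have "even (int S)" using S(1) by presburger
    then have "(int S)\<^sup>2 mod 4 = 0" by (rule square_mod_4)
    then show ?thesis using True m unfolding e_def by presburger
  next
    case False
    then have "odd (int S)" using S(1) by presburger
    then have "(int S)\<^sup>2 mod 4 = 1" by (rule square_mod_4)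
    then show ?thesis using False m unfolding e_def by presburger
  qed
  then have "m mod 4 = 1 \<or> m mod 4 = 2" by (cases e; simp; presburger)
  from exists_parity_ordered[OF three_squares[OF this] m_mod]
  obtain C v w where Cvw: "int m = C\<^sup>2 + v\<^sup>2 + w\<^sup>2" "even C \<noteq> e" "even v = e" "even w = e"
    by (elim exE conjE) (rule that)
  have "int (2 * n + 1) < int ((S + 2)\<^sup>2)" using S(3) by (simp only: of_nat_less_iff)
  then have "2 * int n + 1 < (int S + 2)\<^sup>2" by (simp add: add.commute)
  \<comment> \<open>Maximality of \<open>S\<close> gives \<open>m \<le> 4 S + 3\<close>, and
    \<open>12 S + 9 < (S + 3)^2\<close> holds exactly when \<open>S > 6\<close>.\<close>
  then have "3 * int m < (int S + 3)\<^sup>2"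
  proof -
    have "6 * int S < int S * int S" using \<open>S > 6\<close> by (intro mult_strict_right_mono) auto
    then show ?thesis
      using \<open>2 * int n + 1 < (int S + 2)\<^sup>2\<close> m by (simp add: power2_eq_square algebra_simps)
  qed
  then have small: "\<bar>C\<bar> + \<bar>v\<bar> + \<bar>w\<bar> < int S + 3"
    by (intro sum_abs_bound_of_three_squares) (simp_all add: Cvw(1))
  have eq: "2 * int n + 1 = (int S)\<^sup>2 + C\<^sup>2 + v\<^sup>2 + w\<^sup>2" using m Cvw(1) by simp
  have S_par: "even (int S) = e" using S(1) unfolding e_def by presburger
  have pars: "even (v + w)" "even (C + 1 + w)" using Cvw(2,3,4) by auto
  \<comment> \<open>The sum is even in any case, and reversing the sign of an odd summand changes it
    by 2 modulo 4. Such a summand is \<open>C\<close> if \<open>e\<close> holds and \<open>v\<close>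
    otherwise.\<close>
  consider "4 dvd int S + C + 1 + v + w" | "e" "4 dvd int S + (- C) + 1 + v + w"
    | "\<not> e" "4 dvd int S + C + 1 + (- v) + w"
  proof -
    have "even (int S + C + 1 + v + w)" using Cvw S_par by auto
    then obtain k where k: "int S + C + 1 + v + w = 2 * k" by (elim evenE)
    show ?thesis
    proof (cases "even k")
      case True
      then have "4 dvd int S + C + 1 + v + w" unfolding k by (auto elim!: evenE)
      then show ?thesis by (rule that(1))
    next
      case False
      have four: "4 dvd 2 * k - 2 * x" if "odd x" for x
      proof -
        have "even (k - x)" using that False by simp
        then have "2 * 2 dvd 2 * (k - x)" by (intro mult_dvd_mono) auto
        then show ?thesis by (simp add: algebra_simps)
      qed
      show ?thesis
      proof (cases e)
        case True
        then have "4 dvd 2 * k - 2 * C" using Cvw by (intro four) auto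
        moreover have "2 * k - 2 * C = int S + (- C) + 1 + v + w" using k by simp
        ultimately show ?thesis using that(2) True by simp
      next
        case False
        then have "4 dvd 2 * k - 2 * v" using Cvw by (intro four) auto
        moreover have "2 * k - 2 * v = int S + C + 1 + (- v) + w" using k by simp
        ultimately show ?thesis using that(3) False by simp
      qed
    qed
  qed
  then show ?thesis
  proof cases
    case 1
    show ?thesis by (rule hexagonal_of_four_squares[OF eq small 1 pars])
  next
    case 2
    show ?thesis
      by (rule hexagonal_of_four_squares[of _ "int S" "- C" v w]) (use eq small 2 pars in auto)
  next
    case 3
    show ?thesis
      by (rule hexagonal_of_four_squares[of _ "int S" C "- v" w]) (use eq small 3 pars in auto)
  qed
qed

lemma hexagonal_small:
  fixes n :: nat
  assumes "n \<le> 31"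
  shows "\<exists>a b c d :: nat.
           int n = int a * (2 * int a - 1) + int b * (2 * int b - 1)
                 + int c * (2 * int c + 1) + int d * (2 * int d + 1)"
proof -
  \<comment> \<open>Moving \<open>a + b\<close> to the left avoids truncated subtraction. The ranges
    are exhaustive: the next values, 45 for \<open>a\<close>, \<open>b\<close> and 36 for
    \<open>c\<close>, \<open>d\<close>, exceed 31.\<close>
  have "list_all (\<lambda>n. list_ex (\<lambda>a. list_ex (\<lambda>b. list_ex (\<lambda>c. list_ex (\<lambda>d.
      n + a + b = 2 * a * a + 2 * b * b + c * (2 * c + 1) + d * (2 * d + 1))
      [0..<4]) [0..<4]) [0..<5]) [0..<5]) [0..<32]"
    by code_simp
  then obtain a b c d where "n + a + b = 2 * a * a + 2 * b * b + c * (2 * c + 1) + d * (2 * d + 1)"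
    using assms by (fastforce simp: list_all_iff list_ex_iff)
  then have "int n + int a + int b = int (2 * a * a + 2 * b * b + c * (2 * c + 1) + d * (2 * d + 1))"
    by linarith
  then have "int n = int a * (2 * int a - 1) + int b * (2 * int b - 1)
                 + int c * (2 * int c + 1) + int d * (2 * int d + 1)"
    by (simp add: algebra_simps)
  then show ?thesis by blast
qed

theorem theorem1:
  fixes n :: nat
  shows "\<exists>a b c d :: nat.
           int n = int a * (2 * int a - 1) + int b * (2 * int b - 1)
                 + int c * (2 * int c + 1) + int d * (2 * int d + 1)"
proof (cases "n \<le> 31")
  case True
  then show ?thesis by (rule hexagonal_small)
next
  case False
  then show ?thesis by (intro hexagonal_large) simp
qed

end
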